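(* Let $\mu$ be a positive Borel measure on $\mathbb H$. Assume $0<p_i,q_i<\infty$, $i=1,\ldots,m$, satisfy $\sum_{i=1}^m \frac1{q_i}=1$ and let $\alpha>-1$. Then the following two conditions on $\mu$ are equivalent. (1) There is a constant $C>0$ such that for all functions $f_1,\ldots,f_m$ harmonic in $\mathbb H$, $$\int_{\mathbb H}\prod_{i=1}^m |f_i(z)|^{p_i}\,d\mu(z)\le C\prod_{i=1}^m\left[\sum_{k=1}^\infty\left(\int_{\Delta_k^\ast}|f_i(z)|^{p_i}t^\alpha\,dz\right)^{q_i}\right]^{1/q_i}.$$ (2) There is a constant $C>0$ such that $$\mu(\Delta_k)\le C|\Delta_k|^{m\left(1+\frac{\alpha}{n+1}\right)},\qquad k\ge1.$$
   Context: $\mathbb H=\{(x,t):x\in\mathbb R^n,\ t>0\}\subset\mathbb R^{n+1}$; points are written $z=(x,t)$, and $dz=dm(z)=dx\,dt$ is Lebesgue measure; $|E|$ is the Lebesgue measure of $E\subset\mathbb H$. $A\asymp B$ means $cA\le B\le CA$ for some constants $c,C>0$. $\{\Delta_k\}_{k\ge1}$ is a fixed Whitney decomposition of $\mathbb H$: closed cubes in $\mathbb H$ with sides parallel to the coordinate axes, with pairwise disjoint interiors, $\bigcup_k\Delta_k=\mathbb H$, and $\operatorname{diam}\Delta_k\asymp\operatorname{dist}(\Delta_k,\partial\mathbb H)$ uniformly in $k$. $\Delta_k^\ast$ is the cube with the same center $\zeta_k=(\xi_k,\eta_k)$ as $\Delta_k$ enlarged $5/4$ times; these satisfy $\Delta_k^\ast\subset\mathbb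 H$, $\sum_k\chi_{\Delta_k^\ast}\le C_n$, and $t\asymp\eta_k$ for $(x,t)\in\Delta_k^\ast$, uniformly in $k$. *)

theory Defs
  imports "HOL-Analysis.Analysis"
begin

definition half_space :: "((real ^ 'n) \<times> real) set" where
  "half_space = {z. 0 < snd z}"

definition cube :: "'a::euclidean_space \<Rightarrow> real \<Rightarrow> 'a set" where
  "cube c s = cbox (c - (s / 2) *\<^sub>R One) (c + (s / 2) *\<^sub>R One)"

(* G is the gradient of f and D z the derivative of G at z (the Hessian), so that f is twice
   continuously differentiable; the last line says that the Laplacian, i.e. the trace of D z,
   vanishes. On an open set, G and D are uniquely determined by f. *)
definition harmonic_on :: "'a::euclidean_space set \<Rightarrow> ('a \<Rightarrow> real) \<Rightarrow> bool" where
  "harmonic_on S f \<longleftrightarrow> open S \<and>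
     (\<exists>(G :: 'a \<Rightarrow> 'a) (D :: 'a \<Rightarrow> 'a \<Rightarrow> 'a).
        (\<forall>z\<in>S. (f has_derivative (\<lambda>h. G z \<bullet> h)) (at z)) \<and>
        (\<forall>z\<in>S. (G has_derivative D z) (at z)) \<and>
        (\<forall>h. continuous_on S (\<lambda>z. D z h)) \<and>
        (\<forall>z\<in>S. (\<Sum>b\<in>Basis. D z b \<bullet> b) = 0))"

(* A family of cubes is given by its centers \<zeta> k and side lengths s k. *)
definition whitney_decomposition ::
  "(nat \<Rightarrow> (real ^ 'n) \<times> real) \<Rightarrow> (nat \<Rightarrow> real) \<Rightarrow> bool" where
  "whitney_decomposition \<zeta> s \<longleftrightarrow>
     (\<forall>k. 0 < s k) \<and>
     (\<forall>j k. j \<noteq> k \<longrightarrow> interior (cube (\<zeta> j) (s j)) \<inter> interior (cube (\<zeta> k) (s k)) = {}) \<and>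
     (\<Union>k. cube (\<zeta> k) (s k)) = half_space \<and>
     (\<exists>c>0. \<exists>C>0. \<forall>k.
        c * setdist (cube (\<zeta> k) (s k)) (frontier half_space) \<le> diameter (cube (\<zeta> k) (s k)) \<and>
        diameter (cube (\<zeta> k) (s k)) \<le> C * setdist (cube (\<zeta> k) (s k)) (frontier half_space))"

definition enlarged_cube :: "'a::euclidean_space \<Rightarrow> real \<Rightarrow> 'a set" where
  "enlarged_cube c s = cube c (5 / 4 * s)"

(* The standing properties of the enlarged cubes. They are not implied by
   whitney_decomposition when the constants there are left arbitrary: if the diameters are large
   multiples of the distances to the boundary, the enlarged cubes may leave the half-space. *)
definition whitney_enlargement ::
  "(nat \<Rightarrow> (real ^ 'n) \<times> real) \<Rightarrow> (nat \<Rightarrow> real) \<Rightarrow> bool" where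
  "whitney_enlargement \<zeta> s \<longleftrightarrow>
     (\<forall>k. enlarged_cube (\<zeta> k) (s k) \<subseteq> half_space) \<and>
     (\<exists>N. \<forall>z. finite {k. z \<in> enlarged_cube (\<zeta> k) (s k)} \<and>
              card {k. z \<in> enlarged_cube (\<zeta> k) (s k)} \<le> N) \<and>
     (\<exists>c>0. \<exists>C>0. \<forall>k. \<forall>z\<in>enlarged_cube (\<zeta> k) (s k).
        c * snd (\<zeta> k) \<le> snd z \<and> snd z \<le> C * snd (\<zeta> k))"

(* Real powers on [0, \<infinity>]; only used for exponents a > 0, where \<infinity> powr a = \<infinity> and 0 powr a = 0. *)
definition ennpowr :: "ennreal \<Rightarrow> real \<Rightarrow> ennreal" where
  "ennpowr x a = (if x = \<infinity> then \<infinity> else ennreal (enn2real x powr a))"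

end

(* Carleson condition implies embedding: a harmonic f satisfies |f|^p <= C |D_k|^(-1 - alpha/(n+1)) * (weighted
   integral of |f|^p over the enlarged cube) on D_k, for every p > 0. Hence the left-hand side is at most a
   constant times sum_k prod_i (integral of |f_i|^p_i over the enlarged k-th cube), and Hoelder's inequality for
   series finishes the proof. The pointwise bound comes from a mean value property with a smooth weight and,
   for small p, an argument of Hardy and Littlewood.

   Embedding implies Carleson condition: test with f_i = Re (c w^(N+2)) / |z|^(2 N + n + 3), where z is measured from
   the reflection of the cube's center in the boundary and w = t + i x_1 for one horizontal coordinate x_1. These
   functions are harmonic and decay like |z|^(-N - n - 1), and at each point of the cube one of the choices
   c = 1, c = -i is comparable to eta^(-N - n - 1), eta being the height of the center; so for
   large N their weighted integral over the half-space is finite with the expected scaling. Since q_i >= 1, the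
   sum over the cubes is controlled by that integral and the bounded overlap of the enlarged cubes. *)
theory Submission
  imports Defs
begin

section \<open>A mean value property for harmonic functions\<close>

text \<open>The obstacle in both directions is that the exponents p_i may be small. For p < 1 the
  function |f|^p need not be subharmonic, so the linear mean value property has to be upgraded by an
  extra argument. On the testing side, a function of fixed decay such as the Poisson kernel need not
  have an integrable p-th power against t^\<alpha>, so the order of decay must be adjustable. Kelvin
  transforms of powers of w = t + i x_1 offer every order in every dimension, and their size is
  explicit: |w| is at least the height above the pole and at most the distance to it. All m test
  functions are taken equal, so the integrand on the left is |u|^P with P the sum of the p_i. The
  factor eta^(-(N + n + 1) P) then occurs in the upper bound and in the lower bound and cancels;
  what remains is eta^(m (n + 1 + \<alpha>)), the power of |Delta_k| in (2). In the other direction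
  the same power cancels m factors s_k^(-(n + 1 + \<alpha>)), one from each pointwise bound.\<close>

lemma cball_0_1_subset_cbox: "cball (0::'a::euclidean_space) 1 \<subseteq> cbox (- One) One"
proof
  fix x :: 'a assume "x \<in> cball 0 1"
  then have "\<bar>x \<bullet> i\<bar> \<le> 1" if "i \<in> Basis" for i
    using Basis_le_norm[OF that, of x] by simp
  then show "x \<in> cbox (- One) One"
    by (simp add: mem_box abs_le_iff)
qed

text \<open>Integrals of translates do not depend on the translation. The box has half-side 2, twice
  the radius of the support, so that \<open>g (x + h *\<^sub>R b)\<close> stays supported in it for
  |h| <= 1; differentiating the constant integral at h = 0 gives the claim. This serves as the
  divergence theorem, one direction at a time.\<close>

lemma integral_directional_derivative_eq_0:
  fixes g :: "'a::euclidean_space \<Rightarrow> real"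
  assumes der: "\<And>x. (g has_derivative g' x) (at x)"
    and cont: "continuous_on UNIV (\<lambda>x. g' x b)" and b: "norm b \<le> 1"
    and supp: "\<And>x. x \<notin> cball 0 1 \<Longrightarrow> g x = 0"
  shows "integral (cbox (- (2 *\<^sub>R One)) (2 *\<^sub>R One)) (\<lambda>x. g' x b) = 0"
proof -
  let ?B = "cbox (- (2 *\<^sub>R One)) (2 *\<^sub>R One) :: 'a set"
  have cg: "continuous_on A g" for A
    by (meson der continuous_at_imp_continuous_on has_derivative_continuous)
  obtain I where I: "(g has_integral I) (cbox (- One) One)"
    using integrable_continuous[OF cg, of "- One" One] unfolding integrable_on_def by metis
  have const: "integral ?B (\<lambda>x. g (x + h *\<^sub>R b)) = I" if h: "h \<in> {-1..1}" for h
  proof (rule integral_unique, rule has_integral_on_superset)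
    show "((\<lambda>x. g (x + h *\<^sub>R b)) has_integral I) (cbox (- One - h *\<^sub>R b) (One - h *\<^sub>R b))"
      using has_integral_shift_cbox[OF I] .
    have *: "\<bar>h * (b \<bullet> i)\<bar> \<le> 1" if "i \<in> Basis" for i
      using h b that Basis_le_norm[of i b] mult_mono[of "\<bar>h\<bar>" 1 "\<bar>b \<bullet> i\<bar>" 1] by (auto simp: abs_mult)
    show "cbox (- One - h *\<^sub>R b) (One - h *\<^sub>R b) \<subseteq> ?B"
      unfolding subset_box(1) using * by (auto simp: inner_simps abs_le_iff dest!: bspec)
    fix x assume "x \<notin> cbox (- One - h *\<^sub>R b) (One - h *\<^sub>R b)"
    then have "x + h *\<^sub>R b \<notin> cbox (- One) One"
      by (auto simp: mem_box inner_simps algebra_simps)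
    then show "g (x + h *\<^sub>R b) = 0"
      using cball_0_1_subset_cbox supp by blast
  qed
  have "((\<lambda>h. integral ?B (\<lambda>x. g (x + h *\<^sub>R b))) has_field_derivative
      integral ?B (\<lambda>x. g' (x + 0 *\<^sub>R b) b)) (at 0 within {-1..1})"
  proof (rule leibniz_rule_field_derivative)
    fix h :: real and x :: 'a
    have "((\<lambda>h. g (x + h *\<^sub>R b)) has_derivative (\<lambda>k. g' (x + h *\<^sub>R b) (k *\<^sub>R b))) (at h within {-1..1})"
      by (rule has_derivative_compose[OF _ der]) (auto intro!: derivative_eq_intros)
    moreover have "g' (x + h *\<^sub>R b) (k *\<^sub>R b) = g' (x + h *\<^sub>R b) b * k" for k
      using has_derivative_linear[OF der] by (simp add: linear_cmul)
    ultimately show "((\<lambda>h. g (x + h *\<^sub>R b)) has_field_derivative g' (x + h *\<^sub>R b) b) (at h within {-1..1})"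
      by (simp add: has_field_derivative_def)
  next
    show "continuous_on ({-1..1} \<times> ?B) (\<lambda>(h, x). g' (x + h *\<^sub>R b) b)"
      unfolding split_beta
      by (rule continuous_on_compose2[OF cont]) (auto intro!: continuous_intros)
  next
    fix h :: real
    show "(\<lambda>x. g (x + h *\<^sub>R b)) integrable_on ?B"
      by (intro integrable_continuous continuous_on_compose2[OF cg[of UNIV]] continuous_intros) auto
  qed auto
  moreover have "((\<lambda>h. integral ?B (\<lambda>x. g (x + h *\<^sub>R b))) has_field_derivative 0) (at 0 within {-1..1})"
    by (rule has_field_derivative_transform_within[of "\<lambda>_. I" _ _ _ 1]) (auto simp: const)
  ultimately show ?thesis
    using vector_derivative_unique_within[of 0 "{-1..1::real}"]
    by (simp add: has_real_derivative_iff_has_vector_derivative trivial_limit_within islimpt_Icc)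
qed

text \<open>The gradient of \<open>- (bump y)\<^sup>2 / 4\<close> is \<open>bump y *\<^sub>R y\<close>, so averages against \<open>bump\<close> have a radial derivative
  in divergence form; this replaces spherical means.\<close>

definition bump :: "'a::real_inner \<Rightarrow> real" where
  "bump y = max 0 (1 - y \<bullet> y)"

lemma continuous_on_bump [continuous_intros]:
  "continuous_on A h \<Longrightarrow> continuous_on A (\<lambda>x. bump (h x))"
  unfolding bump_def by (intro continuous_intros)

lemma bump_nonneg: "0 \<le> bump y"
  by (simp add: bump_def)

lemma bump_le_1: "bump y \<le> 1"
  by (simp add: bump_def)

lemma bump_eq_0: "1 \<le> norm y \<Longrightarrow> bump y = 0"
  using power_mono[of 1 "norm y" 2] by (simp add: bump_def power2_norm_eq_inner)

text \<open>Squaring removes the kink of \<open>max 0\<close>: the function (max 0 t)^2 is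
  differentiable at 0 as well, its difference quotient there being at most |t|. The factor -1/4
  cancels the 2 from the square and the -2 from the derivative of 1 - y.y.\<close>

lemma has_derivative_bump_square:
  fixes y :: "'a::euclidean_space"
  shows "((\<lambda>y. - (bump y)\<^sup>2 / 4) has_derivative (\<lambda>h. bump y * (y \<bullet> h))) (at y)"
proof -
  have sq: "((\<lambda>t::real. (max 0 t)\<^sup>2) has_field_derivative 2 * max 0 t) (at t)" for t
  proof -
    consider "t > 0" | "t < 0" | "t = 0" by linarith
    then show ?thesis
    proof cases
      case 1
      then show ?thesis
        by - (rule has_field_derivative_transform_within_open[of "\<lambda>t. t\<^sup>2" _ _ "{0<..}"], auto intro!: derivative_eq_intros)
    next
      case 2
      then show ?thesis
        by - (rule has_field_derivative_transform_within_open[of "\<lambda>t. 0" _ _ "{..<0}"], auto intro!: derivative_eq_intros)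
    next
      case 3
      have "((\<lambda>x::real. (max 0 x)\<^sup>2 / x) \<longlongrightarrow> 0) (at 0)"
      proof (rule tendsto_rabs_zero_cancel, rule tendsto_sandwich[of "\<lambda>_. 0"])
        show "\<forall>\<^sub>F x::real in at 0. \<bar>(max 0 x)\<^sup>2 / x\<bar> \<le> \<bar>x\<bar>"
          by (intro always_eventually) (simp add: power2_eq_square max_def)
        show "((\<lambda>x::real. \<bar>x\<bar>) \<longlongrightarrow> 0) (at 0)"
          by (rule tendsto_rabs_zero) (rule tendsto_ident_at)
      qed auto
      with 3 show ?thesis
        by (simp add: has_field_derivative_iff)
    qed
  qed
  have "((\<lambda>y::'a. 1 - y \<bullet> y) has_derivative (\<lambda>h. - 2 * (y \<bullet> h))) (at y)"
    by (auto intro!: derivative_eq_intros simp: inner_commute)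
  from has_derivative_compose[OF this sq[unfolded has_field_derivative_def]]
  have "((\<lambda>y::'a. (bump y)\<^sup>2) has_derivative (\<lambda>h. 2 * bump y * (- 2 * (y \<bullet> h)))) (at y)"
    by (simp add: bump_def)
  from has_derivative_mult_right[OF this, of "- 1 / 4"] show ?thesis
    by simp
qed

text \<open>Applied with \<open>K\<close> the closed unit ball and \<open>L\<close> the complement
  of the open one (possibly times an interval of radii): \<open>h\<close> involves a function that
  is controlled only on \<open>S\<close>, and its arbitrary values elsewhere are killed by the
  cutoff \<open>w\<close>.\<close>

lemma continuous_on_mult_cutoff:
  fixes h w :: "'a::topological_space \<Rightarrow> real"
  assumes "closed K" "closed L" "continuous_on K h" "continuous_on (K \<union> L) w"
    and "\<And>x. x \<in> L \<Longrightarrow> w x = 0"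
  shows "continuous_on (K \<union> L) (\<lambda>x. h x * w x)"
proof (rule continuous_on_closed_Un[OF assms(1,2)])
  show "continuous_on K (\<lambda>x. h x * w x)"
    using assms continuous_on_subset by (intro continuous_intros) auto
  show "continuous_on L (\<lambda>x. h x * w x)"
    by (rule continuous_on_eq[of _ "\<lambda>_. 0"]) (auto simp: assms)
qed

text \<open>The average of f(z + r y) against \<open>bump\<close> has as r-derivative the integral
  of (grad f)(z + r y) . y bump(y). With W = -bump^2 / 4 this integrand is the divergence in y of
  W(y) (grad f)(z + r y), because grad W = bump(y) y and the other term, r W times the Laplacian of
  f, vanishes. So the average is constant on [0, R], and r = 0 gives the value at z.\<close>

lemma bump_mean_value:
  fixes f :: "'a::euclidean_space \<Rightarrow> real"
  assumes f: "harmonic_on S f" and R: "0 \<le> R" and sub: "cball z R \<subseteq> S"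
  shows "integral (cbox (- (2 *\<^sub>R One)) (2 *\<^sub>R One)) (\<lambda>y. f (z + R *\<^sub>R y) * bump y)
       = f z * integral (cbox (- (2 *\<^sub>R One)) (2 *\<^sub>R One)) (bump :: 'a \<Rightarrow> real)"
proof -
  let ?B = "cbox (- (2 *\<^sub>R One)) (2 *\<^sub>R One) :: 'a set"
  let ?L = "- ball (0::'a) 1"
  obtain G D where S: "open S"
    and GDt: "\<forall>x\<in>S. (f has_derivative (\<lambda>h. G x \<bullet> h)) (at x)" "\<forall>x\<in>S. (G has_derivative D x) (at x)"
      "\<forall>h. continuous_on S (\<lambda>x. D x h)" "\<forall>x\<in>S. (\<Sum>b\<in>Basis. D x b \<bullet> b) = 0"
    using f unfolding harmonic_on_def by (elim exE conjE) (rule that)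
  note G = bspec[OF GDt(1)] and D = bspec[OF GDt(2)] and contD = spec[OF GDt(3)] and tr = bspec[OF GDt(4)]
  have contf: "continuous_on S f" and contG: "continuous_on S G"
    using G D by (meson continuous_at_imp_continuous_on has_derivative_continuous)+
  have UNIV_eq: "cball (0::'a) 1 \<union> ?L = UNIV"
    by auto
  have inS: "z + r *\<^sub>R y \<in> S" if "r \<in> {0..R}" "y \<in> cball 0 1" for r y
  proof -
    have "norm (r *\<^sub>R y) \<le> R"
      using that mult_mono[of r R "norm y" 1] by auto
    then show ?thesis
      using sub by (auto simp: dist_norm)
  qed
  have cont_cut: "continuous_on UNIV (\<lambda>y. h y * w y)"
    if "continuous_on (cball 0 1) h" "continuous_on UNIV w" "\<And>y. y \<in> ?L \<Longrightarrow> w y = 0"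
    for h w :: "'a \<Rightarrow> real"
    using continuous_on_mult_cutoff[of "cball (0::'a) 1" ?L h w] that unfolding UNIV_eq
    by (simp add: closed_Compl)
  have div0: "integral ?B (\<lambda>y. (G (z + r *\<^sub>R y) \<bullet> y) * bump y) = 0" if r: "r \<in> {0..R}" for r
  proof -
    define W :: "'a \<Rightarrow> real" where "W y = - (bump y)\<^sup>2 / 4" for y
    have W0: "W y = 0" if "y \<in> ?L" for y
      using that bump_eq_0[of y] by (simp add: W_def)
    \<comment> \<open>\<open>V' b\<close> is the derivative in direction b of the b-th component of
      the field W(y) G(z + r y); summing over the basis gives its divergence.\<close>
    define V' where "V' b y = (G (z + r *\<^sub>R y) \<bullet> b) * (bump y * (y \<bullet> b)) + (D (z + r *\<^sub>R y) (r *\<^sub>R b) \<bullet> b) * W y"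
      for b y
    have V'_cont: "continuous_on UNIV (V' b)" for b
      unfolding V'_def
    proof (rule continuous_on_add[OF cont_cut[where h="\<lambda>y. G (z + r *\<^sub>R y) \<bullet> b"] cont_cut[where w=W]])
      have *: "continuous_on (cball 0 1) (\<lambda>y. z + r *\<^sub>R y)" "(\<lambda>y. z + r *\<^sub>R y) ` cball 0 1 \<subseteq> S"
        using inS[OF r] by (auto intro!: continuous_intros)
      show "continuous_on (cball 0 1) (\<lambda>y. G (z + r *\<^sub>R y) \<bullet> b)"
        by (intro continuous_intros continuous_on_compose2[OF contG *])
      show "continuous_on (cball 0 1) (\<lambda>y. D (z + r *\<^sub>R y) (r *\<^sub>R b) \<bullet> b)"
        by (intro continuous_intros continuous_on_compose2[OF contD *])
      show "continuous_on UNIV W"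
        unfolding W_def by (intro continuous_intros) auto
      show "bump y * (y \<bullet> b) = 0" if "y \<in> ?L" for y
        using that bump_eq_0[of y] by simp
    qed (auto intro!: continuous_intros simp: W0)
    have V0: "integral ?B (V' b) = 0" if b: "b \<in> Basis" for b
    proof -
      \<comment> \<open>Off the unit ball the point z + r y may leave \<open>S\<close>, where
        \<open>G\<close> and \<open>D\<close> are unconstrained, so the derivative is set to 0
        there; this is its true value, since \<open>W\<close> vanishes. In direction b it still
        agrees with \<open>V' b\<close>.\<close>
      define g' where "g' y h = (if y \<in> cball 0 1 then (G (z + r *\<^sub>R y) \<bullet> b) * (bump y * (y \<bullet> h))
          + (D (z + r *\<^sub>R y) (r *\<^sub>R h) \<bullet> b) * W y else 0)" for y h
      have g'_b: "(\<lambda>y. g' y b) = V' b"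
        by (auto simp: fun_eq_iff g'_def V'_def W_def bump_eq_0)
      have "integral ?B (\<lambda>y. g' y b) = 0"
      proof (rule integral_directional_derivative_eq_0)
        fix y :: 'a
        show "((\<lambda>y. (G (z + r *\<^sub>R y) \<bullet> b) * W y) has_derivative g' y) (at y)"
        proof (cases "y \<in> cball 0 1")
          case True
          have "((\<lambda>y. G (z + r *\<^sub>R y)) has_derivative (\<lambda>h. D (z + r *\<^sub>R y) (r *\<^sub>R h))) (at y)"
            by (rule has_derivative_compose[where f="\<lambda>y. z + r *\<^sub>R y", OF _ D[OF inS[OF r True]]])
               (auto intro!: derivative_eq_intros)
          then have "((\<lambda>y. G (z + r *\<^sub>R y) \<bullet> b) has_derivative (\<lambda>h. D (z + r *\<^sub>R y) (r *\<^sub>R h) \<bullet> b)) (at y)"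
            by (rule has_derivative_inner_left)
          from has_derivative_mult[OF this has_derivative_bump_square[of y]] True
          show ?thesis
            by (simp add: g'_def[abs_def] W_def)
        next
          case False
          have "((\<lambda>_. 0) has_derivative g' y) (at y)"
            using False by (simp add: g'_def[abs_def])
          then show ?thesis
            by (rule has_derivative_transform_within_open[of _ _ _ _ "- cball 0 1"]) (use False W0 in auto)
        qed
      next
        show "continuous_on UNIV (\<lambda>y. g' y b)"
          unfolding g'_b by (rule V'_cont)
      qed (use b W0 in auto)
      then show ?thesis
        by (simp add: g'_b)
    qed
    have "(G (z + r *\<^sub>R y) \<bullet> y) * bump y = (\<Sum>b\<in>Basis. V' b y)" for y
    proof (cases "y \<in> cball 0 1")
      case True
      have "D (z + r *\<^sub>R y) (r *\<^sub>R b) = r *\<^sub>R D (z + r *\<^sub>R y) b" for b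
        using has_derivative_linear[OF D[OF inS[OF r True]]] by (simp add: linear_cmul)
      then have "(\<Sum>b\<in>Basis. V' b y)
         = bump y * (\<Sum>b\<in>Basis. (G (z + r *\<^sub>R y) \<bullet> b) * (y \<bullet> b)) + r * W y * (\<Sum>b\<in>Basis. D (z + r *\<^sub>R y) b \<bullet> b)"
        by (simp add: V'_def sum.distrib sum_distrib_left algebra_simps)
      then show ?thesis
        by (simp add: tr[OF inS[OF r True]] euclidean_inner[of _ y])
    next
      case False
      then show ?thesis
        by (simp add: V'_def W0 bump_eq_0)
    qed
    then have "integral ?B (\<lambda>y. (G (z + r *\<^sub>R y) \<bullet> y) * bump y) = (\<Sum>b\<in>Basis. integral ?B (V' b))"
      by (simp add: integral_sum integrable_continuous continuous_on_subset[OF V'_cont])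
    then show ?thesis
      by (simp add: V0)
  qed
  have "((\<lambda>r. integral ?B (\<lambda>y. f (z + r *\<^sub>R y) * bump y)) has_field_derivative
      integral ?B (\<lambda>y. (G (z + r0 *\<^sub>R y) \<bullet> y) * bump y)) (at r0 within {0..R})"
    if r0: "r0 \<in> {0..R}" for r0
  proof (rule leibniz_rule_field_derivative)
    fix r :: real and y :: 'a assume r: "r \<in> {0..R}"
    show "((\<lambda>r. f (z + r *\<^sub>R y) * bump y) has_field_derivative (G (z + r *\<^sub>R y) \<bullet> y) * bump y) (at r within {0..R})"
    proof (cases "y \<in> cball 0 1")
      case True
      have "((\<lambda>r. f (z + r *\<^sub>R y)) has_derivative (\<lambda>k. G (z + r *\<^sub>R y) \<bullet> (k *\<^sub>R y))) (at r within {0..R})"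
        by (rule has_derivative_compose[where f="\<lambda>r. z + r *\<^sub>R y", OF _ G[OF inS[OF r True]]])
           (auto intro!: derivative_eq_intros)
      then have "((\<lambda>r. f (z + r *\<^sub>R y)) has_field_derivative (G (z + r *\<^sub>R y) \<bullet> y)) (at r within {0..R})"
        by (simp add: has_field_derivative_def mult.commute[of _ "_ \<bullet> _"])
      then show ?thesis
        by (auto intro!: derivative_eq_intros)
    qed (simp add: bump_eq_0)
  next
    fix r :: real assume r: "r \<in> {0..R}"
    have "continuous_on UNIV (\<lambda>y. f (z + r *\<^sub>R y) * bump y)"
    proof (rule cont_cut)
      show "continuous_on (cball 0 1) (\<lambda>y. f (z + r *\<^sub>R y))"
        by (intro continuous_on_compose2[OF contf] continuous_intros) (use inS[OF r] in auto)
    qed (auto intro!: continuous_intros simp: bump_eq_0)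
    then show "(\<lambda>y. f (z + r *\<^sub>R y) * bump y) integrable_on ?B"
      using continuous_on_subset integrable_continuous by blast
  next
    have "continuous_on ({0..R} \<times> cball 0 1 \<union> {0..R} \<times> ?L) (\<lambda>x. (G (z + fst x *\<^sub>R snd x) \<bullet> snd x) * bump (snd x))"
    proof (rule continuous_on_mult_cutoff)
      show "continuous_on ({0..R} \<times> cball 0 1) (\<lambda>x. G (z + fst x *\<^sub>R snd x) \<bullet> snd x)"
        by (intro continuous_on_inner continuous_on_compose2[OF contG] continuous_intros)
           (use inS in \<open>auto simp: mem_Times_iff\<close>)
    qed (auto intro!: closed_Times closed_Compl continuous_intros simp: bump_eq_0)
    then have "continuous_on ({0..R} \<times> UNIV) (\<lambda>x. (G (z + fst x *\<^sub>R snd x) \<bullet> snd x) * bump (snd x))"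
      by (simp add: UNIV_eq flip: Sigma_Un_distrib2)
    then show "continuous_on ({0..R} \<times> ?B) (\<lambda>(r, y). (G (z + r *\<^sub>R y) \<bullet> y) * bump y)"
      unfolding split_beta by (rule continuous_on_subset) auto
  qed (use r0 in auto)
  then obtain c where c: "\<And>r. r \<in> {0..R} \<Longrightarrow> integral ?B (\<lambda>y. f (z + r *\<^sub>R y) * bump y) = c"
    using div0 has_field_derivative_zero_constant[of "{0..R}" "\<lambda>r. integral ?B (\<lambda>y. f (z + r *\<^sub>R y) * bump y)"]
    by auto
  have "integral ?B (\<lambda>y. f (z + R *\<^sub>R y) * bump y) = integral ?B (\<lambda>y. f (z + 0 *\<^sub>R y) * bump y)"
    using c[of R] c[of 0] R by simp
  then show ?thesis
    by simp
qed

lemma integral_bump_pos: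
  "0 < integral (cbox (- (2 *\<^sub>R One)) (2 *\<^sub>R One)) (bump :: 'a::euclidean_space \<Rightarrow> real)"
proof -
  let ?B = "cbox (- (2 *\<^sub>R One)) (2 *\<^sub>R One) :: 'a set"
  have c: "continuous_on ?B bump"
    by (intro continuous_intros)
  have "integral ?B bump \<noteq> 0"
  proof
    assume "integral ?B bump = 0"
    then have "(bump has_integral 0) ?B"
      using integrable_continuous[OF c] by (simp add: has_integral_iff)
    then have "bump (0::'a) = 0"
      using c bump_nonneg by (intro has_integral_0_cbox_imp_0[of "- (2 *\<^sub>R One)" "2 *\<^sub>R One" bump])
        (auto simp: mem_box box_ne_empty)
    then show False
      by (simp add: bump_def)
  qed
  moreover have "0 \<le> integral ?B bump"
    by (rule Henstock_Kurzweil_Integration.integral_nonneg[OF integrable_continuous[OF c] bump_nonneg])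
  ultimately show ?thesis
    by simp
qed

section \<open>Local bounds for powers of harmonic functions\<close>

lemma continuous_on_mult_bump:
  assumes "continuous_on (cball 0 1) h"
  shows "continuous_on A (\<lambda>y::'a::euclidean_space. h y * bump y)"
proof -
  have eq: "cball (0::'a) 1 \<union> - ball 0 1 = UNIV"
    by auto
  have "continuous_on (cball 0 1 \<union> - ball 0 1) (\<lambda>y::'a. h y * bump y)"
    using assms by (intro continuous_on_mult_cutoff continuous_intros closed_Compl) (auto simp: bump_eq_0)
  then show ?thesis
    unfolding eq by (rule continuous_on_subset) simp
qed

lemma nn_integral_lborel_affine:
  fixes f :: "'a::euclidean_space \<Rightarrow> ennreal"
  assumes [measurable]: "f \<in> borel_measurable borel" and "c \<noteq> 0"
  shows "(\<integral>\<^sup>+x. f x \<partial>lborel) = \<bar>c\<bar> ^ DIM('a) * (\<integral>\<^sup>+x. f (t + c *\<^sub>R x) \<partial>lborel)"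
  by (subst lborel_affine[OF \<open>c \<noteq> 0\<close>, of t])
     (simp add: nn_integral_density nn_integral_distr nn_integral_cmult ennreal_power)

text \<open>Above 1/2 write a as a^(1-p) a^p; on [1/2, K] the first factor is at most its value at K
  if p <= 1 and at 1/2 if p > 1, hence the maximum of the two. The inequality converts a linear
  estimate into one for p-th powers, at the price of a term 1/2 that can be absorbed.\<close>

lemma le_half_plus_powr:
  fixes p K :: real
  assumes "0 < K"
  obtains A where "0 < A" "\<And>a. 0 \<le> a \<Longrightarrow> a \<le> K \<Longrightarrow> a \<le> 1 / 2 + A * a powr p"
proof
  let ?A = "max (K powr (1 - p)) ((1 / 2) powr (1 - p))"
  show "0 < ?A"
    using assms by (simp add: max_def)
  fix a :: real assume a: "0 \<le> a" "a \<le> K"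
  consider "a \<le> 1 / 2" | "1 / 2 < a" "p \<le> 1" | "1 / 2 < a" "1 < p" by linarith
  then show "a \<le> 1 / 2 + ?A * a powr p"
  proof cases
    case 1
    have "0 \<le> ?A * a powr p"
      by (simp add: max_def)
    with 1 show ?thesis
      by linarith
  next
    case 2
    then have "a powr (1 - p) * a powr p \<le> ?A * a powr p"
      using a by (intro mult_right_mono order_trans[OF powr_mono2[of "1 - p" a K]]) auto
    with 2 show ?thesis
      by (simp flip: powr_add)
  next
    case 3
    then have "a powr (1 - p) * a powr p \<le> ?A * a powr p"
      by (intro mult_right_mono order_trans[OF powr_mono2'[of "1 - p" "1 / 2" a]]) auto
    with 3 show ?thesis
      by (simp flip: powr_add)
  qed
qed

lemma harmonic_on_continuous_on:
  assumes "harmonic_on S f"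
  shows "continuous_on S f"
proof -
  obtain G where "\<forall>x\<in>S. (f has_derivative (\<lambda>h. G x \<bullet> h)) (at x)"
    using assms unfolding harmonic_on_def by (elim exE conjE) (rule that)
  then show ?thesis
    by (meson continuous_at_imp_continuous_on has_derivative_continuous)
qed

text \<open>The substitution x = z + r y produces the power of r, and \<open>bump\<close> is at most
  1 and vanishes off the unit ball. This is the passage from the gauge integral of the mean value
  property to the Lebesgue integral over a ball.\<close>

lemma integral_bump_le_nn_integral:
  fixes g :: "'a::euclidean_space \<Rightarrow> real"
  assumes g: "continuous_on (cball z r) g" and nn: "\<And>x. 0 \<le> g x" and r: "0 < r"
  shows "ennreal (r ^ DIM('a) * integral (cbox (- (2 *\<^sub>R One)) (2 *\<^sub>R One)) (\<lambda>y. g (z + r *\<^sub>R y) * bump y))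
     \<le> (\<integral>\<^sup>+x\<in>cball z r. ennreal (g x) \<partial>lborel)"
proof -
  let ?B = "cbox (- (2 *\<^sub>R One)) (2 *\<^sub>R One) :: 'a set"
  let ?h = "\<lambda>y. g (z + r *\<^sub>R y) * bump y"
  have in_iff: "z + r *\<^sub>R y \<in> cball z r \<longleftrightarrow> norm y \<le> 1" for y
    using r by (simp add: dist_norm)
  have "continuous_on (cball 0 1) (\<lambda>y. g (z + r *\<^sub>R y))"
    by (intro continuous_on_compose2[OF g] continuous_intros) (use in_iff in auto)
  then have "(?h has_integral integral ?B ?h) ?B"
    by (intro integrable_integral integrable_continuous continuous_on_mult_bump)
  then have "ennreal (integral ?B ?h) = (\<integral>\<^sup>+y. ennreal (indicator ?B y * ?h y) \<partial>lborel)"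
    by (rule nn_integral_has_integral_lebesgue[symmetric, rotated]) (simp add: nn bump_nonneg)
  also have "\<dots> \<le> (\<integral>\<^sup>+y. ennreal (g (z + r *\<^sub>R y)) * indicator (cball z r) (z + r *\<^sub>R y) \<partial>lborel)"
  proof (intro nn_integral_mono)
    fix y
    show "ennreal (indicator ?B y * ?h y) \<le> ennreal (g (z + r *\<^sub>R y)) * indicator (cball z r) (z + r *\<^sub>R y)"
    proof (cases "norm y \<le> 1")
      case True
      have "?h y \<le> g (z + r *\<^sub>R y)"
        using mult_left_mono[OF bump_le_1[of y] nn[of "z + r *\<^sub>R y"]] by simp
      then show ?thesis
        using True in_iff[of y] by (auto intro: ennreal_leI split: split_indicator)
    qed (simp add: bump_eq_0)
  qed
  finally have le: "ennreal (integral ?B ?h) \<le> \<dots>" .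
  have "(\<lambda>x. ennreal (indicator (cball z r) x *\<^sub>R g x)) \<in> borel_measurable borel"
    by (intro measurable_compose[OF borel_measurable_continuous_on_indicator[OF _ g] measurable_ennreal]) simp
  also have "(\<lambda>x. ennreal (indicator (cball z r) x *\<^sub>R g x)) = (\<lambda>x. ennreal (g x) * indicator (cball z r) x)"
    by (auto simp: fun_eq_iff split: split_indicator)
  finally have "(\<integral>\<^sup>+x\<in>cball z r. ennreal (g x) \<partial>lborel) = ennreal r ^ DIM('a) *
      (\<integral>\<^sup>+y. ennreal (g (z + r *\<^sub>R y)) * indicator (cball z r) (z + r *\<^sub>R y) \<partial>lborel)"
    using r by (subst nn_integral_lborel_affine[of _ r z]) (auto simp: ennreal_power)
  with le r show ?thesis
    by (simp add: ennreal_mult' ennreal_power mult_left_mono)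
qed

text \<open>Hardy and Littlewood: at a maximum point \<open>w\<close> of \<open>\<bar>f\<bar> powr p\<close> times a power of the distance to
  the sphere, \<open>\<bar>f\<bar>\<close> is bounded by a multiple of \<open>\<bar>f w\<bar>\<close> on a ball of comparable radius, which makes
  the mean value property available for every exponent \<open>p > 0\<close>.\<close>

lemma harmonic_powr_le_nn_integral:
  fixes p :: real
  assumes p: "0 < p"
  obtains C where "0 < C"
    "\<And>(f :: 'a::euclidean_space \<Rightarrow> real) S z R. harmonic_on S f \<Longrightarrow> 0 < R \<Longrightarrow> cball z R \<subseteq> S \<Longrightarrow>
       ennreal (\<bar>f z\<bar> powr p * R ^ DIM('a)) \<le> ennreal C * (\<integral>\<^sup>+x\<in>cball z R. ennreal (\<bar>f x\<bar> powr p) \<partial>lborel)"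
proof -
  let ?B = "cbox (- (2 *\<^sub>R One)) (2 *\<^sub>R One) :: 'a set"
  let ?d = "DIM('a)"
  define I where "I = integral ?B bump"
  have I: "0 < I"
    unfolding I_def by (rule integral_bump_pos)
  \<comment> \<open>With this exponent the p-th power of (distance)^e is (distance)^d, d being the
    dimension: exactly the volume factor of the claim.\<close>
  define e where "e = ?d / p"
  have e: "0 < e" using p by (simp add: e_def)
  \<comment> \<open>2^e will bound the ratio |f x| / |f w| on the smaller ball.\<close>
  obtain A where A: "0 < A" "\<And>a. 0 \<le> a \<Longrightarrow> a \<le> 2 powr e \<Longrightarrow> a \<le> 1 / 2 + A * a powr p"
    by (rule le_half_plus_powr[of "2 powr e" p]) auto
  \<comment> \<open>2^d comes from the radius 2 \<rho>, the factor 2 from absorbing half of |f w| I,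
    and 1 / I from normalizing the weight.\<close>
  define C where "C = 2 ^ ?d * (2 * A / I)"
  have "ennreal (\<bar>f z\<bar> powr p * R ^ ?d) \<le> ennreal C * (\<integral>\<^sup>+x\<in>cball z R. ennreal (\<bar>f x\<bar> powr p) \<partial>lborel)"
    if f: "harmonic_on S f" and R: "0 < R" and sub: "cball z R \<subseteq> S" for f :: "'a \<Rightarrow> real" and S z R
  proof -
    define \<phi> where "\<phi> x = \<bar>f x\<bar> * (R - dist z x) powr e" for x
    have contf: "continuous_on (cball z R) f"
      using harmonic_on_continuous_on[OF f] sub continuous_on_subset by blast
    have "continuous_on (cball z R) \<phi>"
      unfolding \<phi>_def using e by (intro continuous_intros contf continuous_on_powr') auto
    then obtain w where w: "w \<in> cball z R" and w_max: "\<And>x. x \<in> cball z R \<Longrightarrow> \<phi> x \<le> \<phi> w"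
      using continuous_attains_sup[of "cball z R" \<phi>] R by auto
    have \<phi>z: "\<phi> z = \<bar>f z\<bar> * R powr e"
      by (simp add: \<phi>_def)
    have \<phi>_powr: "(\<bar>f x\<bar> * t powr e) powr p = \<bar>f x\<bar> powr p * t ^ ?d" if "0 < t" for x t
      using that p by (simp add: powr_mult powr_powr e_def powr_realpow)
    \<comment> \<open>A zero of f at z is set apart so that the maximum of \<phi> is positive, which
      forces f w to be nonzero and w to lie strictly inside the sphere.\<close>
    show ?thesis
    proof (cases "f z = 0")
      case True
      then show ?thesis by simp
    next
      case False
      then have "0 < \<phi> z"
        using R by (simp add: \<phi>z)
      then have "0 < \<phi> w"
        using w_max[of z] R by simp
      then have fw: "0 < \<bar>f w\<bar>" and "R - dist z w \<noteq> 0"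
        by (auto simp: \<phi>_def zero_less_mult_iff)
      with w have pos: "0 < R - dist z w" by simp
      \<comment> \<open>Within half the distance from w to the sphere, every point keeps at least
        half of that distance, so the maximality of \<phi> at w costs only the factor 2^e.\<close>
      define \<rho> where "\<rho> = (R - dist z w) / 2"
      have \<rho>: "0 < \<rho>" using pos by (simp add: \<rho>_def)
      have \<rho>2: "R - dist z w = 2 * \<rho>" by (simp add: \<rho>_def)
      have dist_ge: "\<rho> \<le> R - dist z x" if "x \<in> cball w \<rho>" for x
        using dist_triangle[of z x w] that by (simp add: \<rho>_def field_simps)
      have sub_w: "cball w \<rho> \<subseteq> cball z R"
        using dist_ge \<rho> by fastforce
      have fx_le: "\<bar>f x\<bar> \<le> 2 powr e * \<bar>f w\<bar>" if x: "x \<in> cball w \<rho>" for x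
      proof -
        have "\<bar>f x\<bar> * \<rho> powr e \<le> \<phi> x"
          unfolding \<phi>_def using dist_ge[OF x] \<rho> e by (intro mult_left_mono powr_mono2) auto
        also have "\<dots> \<le> \<phi> w"
          using w_max sub_w x by blast
        also have "\<dots> = \<bar>f w\<bar> * (2 * \<rho>) powr e"
          by (simp add: \<phi>_def \<rho>2)
        also have "\<dots> = 2 powr e * \<bar>f w\<bar> * \<rho> powr e"
          using \<rho> by (simp add: powr_mult)
        finally show ?thesis
          using \<rho> by simp
      qed
      have in_w: "w + \<rho> *\<^sub>R y \<in> cball w \<rho>" if "norm y \<le> 1" for y
        using that \<rho> by (simp add: dist_norm)
      have cont_w: "continuous_on (cball w \<rho>) f"
        using contf sub_w continuous_on_subset by blast
      have cont1: "continuous_on (cball 0 1) (\<lambda>y. f (w + \<rho> *\<^sub>R y))"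
        by (intro continuous_on_compose2[OF cont_w] continuous_intros) (use in_w in auto)
      define J where "J = integral ?B (\<lambda>y. \<bar>f (w + \<rho> *\<^sub>R y)\<bar> powr p * bump y)"
      have intJ: "(\<lambda>y. \<bar>f (w + \<rho> *\<^sub>R y)\<bar> powr p * bump y) integrable_on ?B"
        using p by (intro integrable_continuous continuous_on_mult_bump continuous_on_powr' continuous_intros cont1) auto
      have int_bump: "bump integrable_on ?B"
        by (intro integrable_continuous continuous_intros)
      let ?a = "\<bar>f w\<bar>"
      have "?a * I = norm (integral ?B (\<lambda>y. f (w + \<rho> *\<^sub>R y) * bump y))"
        using bump_mean_value[OF f less_imp_le[OF \<rho>], of w] sub_w sub I
        by (simp add: I_def abs_mult)
      also have "\<dots> \<le> integral ?B (\<lambda>y. ?a / 2 * bump y + A * ?a powr (1 - p) * (\<bar>f (w + \<rho> *\<^sub>R y)\<bar> powr p * bump y))"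
      proof (rule integral_norm_bound_integral)
        show "(\<lambda>y. f (w + \<rho> *\<^sub>R y) * bump y) integrable_on ?B"
          by (intro integrable_continuous continuous_on_mult_bump cont1)
        show "(\<lambda>y. ?a / 2 * bump y + A * ?a powr (1 - p) * (\<bar>f (w + \<rho> *\<^sub>R y)\<bar> powr p * bump y)) integrable_on ?B"
          by (intro integrable_add integrable_on_mult_right int_bump intJ)
        fix y :: 'a
        show "norm (f (w + \<rho> *\<^sub>R y) * bump y) \<le> ?a / 2 * bump y + A * ?a powr (1 - p) * (\<bar>f (w + \<rho> *\<^sub>R y)\<bar> powr p * bump y)"
        proof (cases "norm y \<le> 1")
          case True
          let ?b = "\<bar>f (w + \<rho> *\<^sub>R y)\<bar>"
          have "?b / ?a \<le> 2 powr e"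
            using fx_le[OF in_w[OF True]] fw by (simp add: divide_simps)
          \<comment> \<open>The splitting is applied to the ratio, so that the term 1/2 integrates
            to half of |f w| I and can be absorbed on the left.\<close>
          then have "?b / ?a \<le> 1 / 2 + A * (?b / ?a) powr p"
            by (intro A(2)) auto
          then have "?b \<le> (1 / 2 + A * (?b / ?a) powr p) * ?a"
            using fw by (simp add: divide_simps)
          also have "\<dots> = ?a / 2 + A * ?a powr (1 - p) * ?b powr p"
            using fw by (simp add: powr_divide powr_diff field_simps)
          finally have "?b * bump y \<le> (?a / 2 + A * ?a powr (1 - p) * ?b powr p) * bump y"
            by (rule mult_right_mono[OF _ bump_nonneg])
          then show ?thesis
            by (simp add: abs_mult bump_nonneg algebra_simps)
        qed (simp add: bump_eq_0)
      qed
      also have "\<dots> = ?a / 2 * I + A * ?a powr (1 - p) * J"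
        using int_bump intJ by (simp add: Henstock_Kurzweil_Integration.integral_add integrable_on_mult_right I_def J_def
            del: mult.assoc)
      finally have "?a * I / 2 \<le> A * ?a powr (1 - p) * J"
        by linarith
      also have "?a powr (1 - p) = ?a / ?a powr p"
        using fw by (simp add: powr_diff)
      finally have "?a * I / 2 \<le> A * (?a / ?a powr p) * J" .
      then have aJ: "?a powr p \<le> 2 * A / I * J"
        using fw I by (simp add: field_simps)
      have "\<bar>f z\<bar> powr p * R ^ ?d = \<phi> z powr p"
        using R by (simp add: \<phi>z \<phi>_powr)
      also have "\<dots> \<le> \<phi> w powr p"
        using \<open>0 < \<phi> z\<close> w_max[of z] R p by (intro powr_mono2) auto
      also have "\<dots> = ?a powr p * (2 * \<rho>) ^ ?d"
        using \<rho> by (simp add: \<phi>_def \<rho>2 \<phi>_powr)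
      also have "\<dots> \<le> 2 * A / I * J * (2 * \<rho>) ^ ?d"
        using \<rho> by (intro mult_right_mono aJ) simp
      also have "\<dots> = C * (\<rho> ^ ?d * J)"
        by (simp add: C_def power_mult_distrib)
      finally have "ennreal (\<bar>f z\<bar> powr p * R ^ ?d) \<le> ennreal C * ennreal (\<rho> ^ ?d * J)"
        using A I by (simp add: C_def ennreal_leI flip: ennreal_mult')
      also have "\<dots> \<le> ennreal C * (\<integral>\<^sup>+x\<in>cball w \<rho>. ennreal (\<bar>f x\<bar> powr p) \<partial>lborel)"
        unfolding J_def using p \<rho>
        by (intro mult_left_mono integral_bump_le_nn_integral continuous_on_powr' continuous_intros cont_w) auto
      also have "\<dots> \<le> ennreal C * (\<integral>\<^sup>+x\<in>cball z R. ennreal (\<bar>f x\<bar> powr p) \<partial>lborel)"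
        using sub_w by (intro mult_left_mono nn_integral_mono) (auto split: split_indicator)
      finally show ?thesis .
    qed
  qed
  moreover have "0 < C"
    using A I by (simp add: C_def)
  ultimately show ?thesis
    using that by blast
qed

section \<open>Hoelder's inequality for series\<close>

lemma ennpowr_ennreal: "0 \<le> x \<Longrightarrow> ennpowr (ennreal x) a = ennreal (x powr a)"
  by (simp add: ennpowr_def)

lemma ennpowr_top [simp]: "ennpowr top a = top"
  by (simp add: ennpowr_def)

lemma ennpowr_eq_0: "ennpowr x a = 0 \<longleftrightarrow> x = 0"
  by (cases x rule: ennreal_cases) (simp_all add: ennpowr_ennreal)

lemma ennpowr_eq_top: "ennpowr x a = top \<longleftrightarrow> x = top"
  by (cases x rule: ennreal_cases) (simp_all add: ennpowr_ennreal)

lemma ennpowr_mono: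
  assumes "0 < a" "x \<le> y"
  shows "ennpowr x a \<le> ennpowr y a"
proof (cases "y = top")
  case False
  with assms(2) have "x \<noteq> top"
    by (metis top_unique)
  with False assms show ?thesis
    by (cases x rule: ennreal_cases; cases y rule: ennreal_cases)
       (simp_all add: ennpowr_ennreal ennreal_leI powr_mono2)
qed simp

lemma ennpowr_ennpowr_inverse: "0 < a \<Longrightarrow> ennpowr (ennpowr x a) (1 / a) = x"
  by (cases x rule: ennreal_cases) (simp_all add: ennpowr_ennreal powr_powr)

text \<open>Superadditivity of t^a for a >= 1: in u^a = u^(a-1) u and v^a = v^(a-1) v the first
  factors are at most (u + v)^(a-1). It expresses that the l^a norm is at most the l^1 norm.\<close>

lemma sum_ennpowr_le:
  assumes "1 \<le> a" "finite A"
  shows "(\<Sum>k\<in>A. ennpowr (x k) a) \<le> ennpowr (\<Sum>k\<in>A. x k) a"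
  using \<open>finite A\<close>
proof induction
  case empty
  show ?case by simp
next
  case (insert k A)
  have add: "ennpowr u a + ennpowr v a \<le> ennpowr (u + v) a" for u v
  proof (cases "u = top \<or> v = top")
    case True
    then show ?thesis by auto
  next
    case False
    then obtain r t where rt: "u = ennreal r" "v = ennreal t" "0 \<le> r" "0 \<le> t"
      by (metis ennreal_cases)
    have split: "y powr a = y powr (a - 1) * y" if "0 \<le> y" for y :: real
      using that by (cases "y = 0") (auto simp: powr_diff)
    have "r powr a + t powr a \<le> (r + t) powr (a - 1) * r + (r + t) powr (a - 1) * t"
      unfolding split[OF rt(3)] split[OF rt(4)] using assms rt
      by (intro add_mono mult_right_mono powr_mono2) auto
    also have "\<dots> = (r + t) powr a"
      using split[of "r + t"] rt by (simp add: algebra_simps)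
    finally show ?thesis
      using rt by (simp add: ennpowr_ennreal ennreal_leI flip: ennreal_plus)
  qed
  show ?case
    using insert.hyps order_trans[OF add_left_mono[OF insert.IH] add] by simp
qed

lemma suminf_ennpowr_le:
  assumes "1 \<le> a"
  shows "(\<Sum>k. ennpowr (x k) a) \<le> ennpowr (\<Sum>k. x k) a"
proof (rule suminf_le_const[OF summableI])
  fix n
  have "(\<Sum>k<n. ennpowr (x k) a) \<le> ennpowr (\<Sum>k<n. x k) a"
    using assms by (intro sum_ennpowr_le) auto
  also have "\<dots> \<le> ennpowr (\<Sum>k. x k) a"
    using assms by (intro ennpowr_mono sum_le_suminf) auto
  finally show "(\<Sum>k<n. ennpowr (x k) a) \<le> ennpowr (\<Sum>k. x k) a" .
qed

text \<open>Jensen's inequality for \<open>exp\<close> at the points \<open>ln (x i)\<close>. A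
  vanishing \<open>x i\<close> is treated apart; since \<open>0 powr 0 = 0\<close>, the product is
  then 0 whatever the weight.\<close>

lemma weighted_arith_geom_mean:
  fixes x w :: "'a \<Rightarrow> real"
  assumes "finite I" "I \<noteq> {}" "\<And>i. i \<in> I \<Longrightarrow> 0 \<le> w i" "(\<Sum>i\<in>I. w i) = 1" "\<And>i. i \<in> I \<Longrightarrow> 0 \<le> x i"
  shows "(\<Prod>i\<in>I. x i powr w i) \<le> (\<Sum>i\<in>I. w i * x i)"
proof (cases "\<exists>i\<in>I. x i = 0")
  case True
  then have "(\<Prod>i\<in>I. x i powr w i) = 0"
    using assms by auto
  also have "0 \<le> (\<Sum>i\<in>I. w i * x i)"
    using assms by (intro sum_nonneg mult_nonneg_nonneg)
  finally show ?thesis .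
next
  case False
  then have pos: "0 < x i" if "i \<in> I" for i
    using assms(5)[OF that] that by force
  have "(\<Prod>i\<in>I. x i powr w i) = exp (\<Sum>i\<in>I. w i * ln (x i))"
    unfolding exp_sum[OF \<open>finite I\<close>]
  proof (rule prod.cong)
    fix i assume "i \<in> I"
    then show "x i powr w i = exp (w i * ln (x i))"
      using pos[of i] by (simp add: powr_def)
  qed simp
  also have "\<dots> \<le> (\<Sum>i\<in>I. w i * exp (ln (x i)))"
    using convex_on_sum[OF assms(1,2) exp_convex assms(4,3), of "\<lambda>i. ln (x i)"] by simp
  also have "\<dots> = (\<Sum>i\<in>I. w i * x i)"
    using pos by simp
  finally show ?thesis .
qed

lemma le_suminf_ennreal: "f k \<le> (\<Sum>k. f k :: ennreal)"
  using sum_le_suminf[OF summableI, of "{k}" f] by simp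

text \<open>Normalize each sequence by its sum \<open>T i\<close>, apply the weighted mean
  inequality with weights 1 / q_i to the terms with index k, and sum over k: the i-th part
  contributes P / q_i, and these add up to P, the right-hand side.\<close>

lemma Hoelder_suminf_prod_ennreal:
  fixes a :: "'a \<Rightarrow> nat \<Rightarrow> ennreal" and q :: "'a \<Rightarrow> real"
  assumes I: "finite I" and q: "\<And>i. i \<in> I \<Longrightarrow> 0 < q i" "(\<Sum>i\<in>I. 1 / q i) = 1"
  shows "(\<Sum>k. \<Prod>i\<in>I. a i k) \<le> (\<Prod>i\<in>I. ennpowr (\<Sum>k. ennpowr (a i k) (q i)) (1 / q i))"
proof -
  define T where "T i = (\<Sum>k. ennpowr (a i k) (q i))" for i
  have I': "I \<noteq> {}"
    using q(2) by auto
  have le_T: "ennpowr (a i k) (q i) \<le> T i" for i k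
    unfolding T_def by (rule le_suminf_ennreal)
  \<comment> \<open>Vanishing sums come before infinite ones because 0 * \<infinity> = 0 in
    \<open>ennreal\<close>: the right-hand side is infinite only if no factor is 0.\<close>
  consider i where "i \<in> I" "T i = 0" | i where "i \<in> I" "T i = top" "\<And>i. i \<in> I \<Longrightarrow> T i \<noteq> 0"
    | "\<And>i. i \<in> I \<Longrightarrow> T i \<noteq> 0 \<and> T i \<noteq> top" by blast
  then have "(\<Sum>k. \<Prod>i\<in>I. a i k) \<le> (\<Prod>i\<in>I. ennpowr (T i) (1 / q i))"
  proof cases
    case (1 i)
    have "a i k = 0" for k
      using le_T[of i k] 1 by (simp add: ennpowr_eq_0)
    then have "(\<lambda>k. \<Prod>i\<in>I. a i k) = (\<lambda>_. 0)"
      using \<open>i \<in> I\<close> I by (intro ext prod_zero) auto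
    then show ?thesis by (simp only: suminf_zero zero_le)
  next
    case (2 i)
    have "(\<Prod>i\<in>I. ennpowr (T i) (1 / q i)) = top"
      using 2 I by (auto simp: ennreal_prod_eq_top ennpowr_eq_0 ennpowr_eq_top)
    then show ?thesis by simp
  next
    case 3
    define t where "t i = enn2real (T i)" for i
    have t: "T i = ennreal (t i)" "0 < t i" if "i \<in> I" for i
      using 3[OF that] by (simp_all add: t_def enn2real_positive_iff zero_less_iff_neq_zero flip: less_top)
    define b where "b i k = enn2real (a i k)" for i k
    have ab: "a i k = ennreal (b i k)" if "i \<in> I" for i k
    proof -
      have "a i k \<noteq> top"
        using le_T[of i k] 3[OF that] by (auto simp: top_unique)
      then show ?thesis by (simp add: b_def less_top)
    qed
    have b0: "0 \<le> b i k" for i k by (simp add: b_def)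
    define P where "P = (\<Prod>i\<in>I. t i powr (1 / q i))"
    \<comment> \<open>The normalization is moved into the coefficients, which leaves a bound linear
      in the q_i-th powers that can be summed over k.\<close>
    define e where "e i = P * (1 / q i) / t i" for i
    have e: "0 \<le> e i" "e i * t i = P * (1 / q i)" if "i \<in> I" for i
      using q(1)[OF that] t(2)[OF that] by (simp_all add: e_def P_def prod_nonneg)
    have prod_le: "(\<Prod>i\<in>I. a i k) \<le> (\<Sum>i\<in>I. ennreal (e i) * ennpowr (a i k) (q i))" for k
    proof -
      have "(\<Prod>i\<in>I. b i k) = P * (\<Prod>i\<in>I. (b i k powr q i / t i) powr (1 / q i))"
        unfolding P_def prod.distrib[symmetric] using q(1) t b0
        by (intro prod.cong) (auto simp: powr_divide powr_powr less_imp_neq[symmetric])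
      also have "\<dots> \<le> P * (\<Sum>i\<in>I. 1 / q i * (b i k powr q i / t i))"
        using q t(2) b0 I I'
        by (intro mult_left_mono weighted_arith_geom_mean) (auto simp: P_def less_imp_le intro!: prod_nonneg)
      also have "\<dots> = (\<Sum>i\<in>I. e i * b i k powr q i)"
        by (simp add: sum_distrib_left e_def)
      finally have "ennreal (\<Prod>i\<in>I. b i k) \<le> ennreal (\<Sum>i\<in>I. e i * b i k powr q i)"
        by (rule ennreal_leI)
      moreover have "ennreal (\<Prod>i\<in>I. b i k) = (\<Prod>i\<in>I. a i k)"
        using ab b0 by (simp add: prod_ennreal[symmetric])
      moreover have "ennreal (\<Sum>i\<in>I. e i * b i k powr q i) = (\<Sum>i\<in>I. ennreal (e i) * ennpowr (a i k) (q i))"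
      proof -
        have "(\<Sum>i\<in>I. ennreal (e i) * ennpowr (a i k) (q i)) = (\<Sum>i\<in>I. ennreal (e i * b i k powr q i))"
          using e b0 by (intro sum.cong) (simp_all add: ab ennpowr_ennreal ennreal_mult')
        then show ?thesis
          using e b0 by (simp add: sum_ennreal)
      qed
      ultimately show ?thesis by simp
    qed
    have "(\<Sum>k. \<Prod>i\<in>I. a i k) \<le> (\<Sum>k. \<Sum>i\<in>I. ennreal (e i) * ennpowr (a i k) (q i))"
      by (intro suminf_le prod_le summableI)
    also have "\<dots> = (\<Sum>i\<in>I. ennreal (e i) * T i)"
      by (subst suminf_sum) (auto simp: T_def)
    also have "\<dots> = (\<Sum>i\<in>I. ennreal (P * (1 / q i)))"
    proof (intro sum.cong refl)
      fix i assume "i \<in> I"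
      then show "ennreal (e i) * T i = ennreal (P * (1 / q i))"
        using t e by (simp flip: ennreal_mult')
    qed
    also have "\<dots> = ennreal (P * (\<Sum>i\<in>I. 1 / q i))"
      unfolding sum_distrib_left using q(1)
      by (intro sum_ennreal) (auto simp: P_def intro!: prod_nonneg divide_nonneg_pos)
    also have "\<dots> = (\<Prod>i\<in>I. ennreal (t i powr (1 / q i)))"
      by (simp add: q(2) P_def prod_ennreal)
    also have "\<dots> = (\<Prod>i\<in>I. ennpowr (T i) (1 / q i))"
      using t by (intro prod.cong) (simp_all add: ennpowr_ennreal less_imp_le)
    finally show ?thesis .
  qed
  then show ?thesis
    by (simp add: T_def)
qed

section \<open>Harmonic test functions of rapid decay\<close>

text \<open>The smoothness part of \<open>harmonic_on\<close> with gradient and Hessian exposed, so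
  that explicit formulas can be combined by the product rule before the trace is computed.\<close>

definition has_hessian :: "'a::euclidean_space set \<Rightarrow> ('a \<Rightarrow> real) \<Rightarrow> ('a \<Rightarrow> 'a) \<Rightarrow> ('a \<Rightarrow> 'a \<Rightarrow> 'a) \<Rightarrow> bool" where
  "has_hessian S f G D \<longleftrightarrow> (\<forall>z\<in>S. (f has_derivative (\<lambda>h. G z \<bullet> h)) (at z)) \<and>
     (\<forall>z\<in>S. (G has_derivative D z) (at z)) \<and> (\<forall>h. continuous_on S (\<lambda>z. D z h))"

lemma harmonic_on_has_hessian:
  assumes "open S" "has_hessian S f G D" "\<And>z. z \<in> S \<Longrightarrow> (\<Sum>b\<in>Basis. D z b \<bullet> b) = 0"
  shows "harmonic_on S f"
  using assms unfolding harmonic_on_def has_hessian_def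
  by (intro conjI exI[of _ G] exI[of _ D]) auto

lemma has_hessian_mult:
  assumes f: "has_hessian S f G D" and g: "has_hessian S g H E"
  shows "has_hessian S (\<lambda>z. f z * g z) (\<lambda>z. f z *\<^sub>R H z + g z *\<^sub>R G z)
    (\<lambda>z h. (f z *\<^sub>R E z h + (G z \<bullet> h) *\<^sub>R H z) + (g z *\<^sub>R D z h + (H z \<bullet> h) *\<^sub>R G z))"
proof -
  have c: "continuous_on S f" "continuous_on S g" "continuous_on S G" "continuous_on S H"
    using f g unfolding has_hessian_def
    by (meson continuous_at_imp_continuous_on has_derivative_continuous)+
  have fd: "(f has_derivative (\<lambda>h. G z \<bullet> h)) (at z)" "(G has_derivative D z) (at z)"
    and gd: "(g has_derivative (\<lambda>h. H z \<bullet> h)) (at z)" "(H has_derivative E z) (at z)" if "z \<in> S" for z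
    using f g that by (auto simp: has_hessian_def)
  show ?thesis
    unfolding has_hessian_def
  proof (intro conjI ballI allI)
    fix z assume z: "z \<in> S"
    show "((\<lambda>z. f z * g z) has_derivative (\<lambda>h. (f z *\<^sub>R H z + g z *\<^sub>R G z) \<bullet> h)) (at z)"
      using has_derivative_mult[OF fd(1)[OF z] gd(1)[OF z]] by (simp add: algebra_simps)
    show "((\<lambda>z. f z *\<^sub>R H z + g z *\<^sub>R G z) has_derivative
        (\<lambda>h. (f z *\<^sub>R E z h + (G z \<bullet> h) *\<^sub>R H z) + (g z *\<^sub>R D z h + (H z \<bullet> h) *\<^sub>R G z))) (at z)"
      by (intro has_derivative_add has_derivative_scaleR fd gd z)
  next
    fix h
    show "continuous_on S (\<lambda>z. (f z *\<^sub>R E z h + (G z \<bullet> h) *\<^sub>R H z) + (g z *\<^sub>R D z h + (H z \<bullet> h) *\<^sub>R G z))"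
      using f g by (intro continuous_intros c) (auto simp: has_hessian_def)
  qed
qed

text \<open>With \<open>e2\<close> the vertical direction the real part is the height. Once the pole
  is moved below the boundary, this keeps the modulus away from 0 over the half-space.\<close>

definition planar :: "'a::euclidean_space \<Rightarrow> 'a \<Rightarrow> 'a \<Rightarrow> complex" where
  "planar e1 e2 z = Complex (z \<bullet> e2) (z \<bullet> e1)"

lemma bounded_linear_planar: "bounded_linear (planar e1 e2)"
proof -
  have "planar e1 e2 = (\<lambda>z. of_real (z \<bullet> e2) + \<i> * of_real (z \<bullet> e1))"
    by (simp add: planar_def complex_eq_iff fun_eq_iff)
  then show ?thesis
    by (simp add: bounded_linear_add bounded_linear_const_mult bounded_linear_compose[OF bounded_linear_of_real]
        bounded_linear_inner_left)
qed

text \<open>\<open>V X\<close> represents the linear form that sends h to Re (X * planar h). Hence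
  the real gradient is \<open>V\<close> of the complex derivative, and the Hessian in direction h is
  \<open>V\<close> of the second complex derivative times planar h.\<close>

lemma has_hessian_Re_planar_power:
  fixes e1 e2 :: "'a::euclidean_space"
  defines "V \<equiv> \<lambda>X. Re X *\<^sub>R e2 - Im X *\<^sub>R e1"
  shows "has_hessian UNIV (\<lambda>z. Re (c * planar e1 e2 z ^ (N + 2)))
     (\<lambda>z. V (c * of_nat (N + 2) * planar e1 e2 z ^ (N + 1)))
     (\<lambda>z h. V (c * of_nat (N + 2) * (of_nat (N + 1) * planar e1 e2 z ^ N * planar e1 e2 h)))"
proof -
  let ?w = "planar e1 e2"
  have w: "(?w has_derivative ?w) (at z)" for z
    using bounded_linear_planar by (rule bounded_linear_imp_has_derivative)
  have V: "bounded_linear V"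
    unfolding V_def
    by (intro bounded_linear_sub bounded_linear_compose[OF bounded_linear_scaleR_left] bounded_linear_Re bounded_linear_Im)
  have V_inner: "V X \<bullet> h = Re (X * ?w h)" for X h
    by (simp add: V_def planar_def inner_simps inner_commute)
  have pow: "((\<lambda>z. ?w z ^ (n + 1)) has_derivative (\<lambda>h. of_nat (n + 1) * ?w z ^ n * ?w h)) (at z)" for n z
    using has_derivative_power[OF w, where n="n + 1"] by (simp add: ac_simps)
  show ?thesis
    unfolding has_hessian_def
  proof (intro conjI ballI allI)
    fix z
    have "((\<lambda>z. Re (c * ?w z ^ (Suc N + 1))) has_derivative (\<lambda>h. Re (c * (of_nat (Suc N + 1) * ?w z ^ Suc N * ?w h)))) (at z)"
      by (intro has_derivative_Re has_derivative_mult_right pow)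
    then show "((\<lambda>z. Re (c * ?w z ^ (N + 2))) has_derivative (\<lambda>h. V (c * of_nat (N + 2) * ?w z ^ (N + 1)) \<bullet> h)) (at z)"
      by (simp add: V_inner ac_simps)
    show "((\<lambda>z. V (c * of_nat (N + 2) * ?w z ^ (N + 1))) has_derivative
        (\<lambda>h. V (c * of_nat (N + 2) * (of_nat (N + 1) * ?w z ^ N * ?w h)))) (at z)"
      by (intro bounded_linear.has_derivative[OF V] has_derivative_mult_right pow)
  next
    fix h
    show "continuous_on UNIV (\<lambda>z. V (c * of_nat (N + 2) * (of_nat (N + 1) * ?w z ^ N * ?w h)))"
      by (intro bounded_linear.continuous_on[OF V] bounded_linear.continuous_on[OF bounded_linear_planar] continuous_intros)
  qed
qed

lemma has_hessian_inner_powr: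
  "has_hessian (- {0}) (\<lambda>z::'a::euclidean_space. (z \<bullet> z) powr r)
     (\<lambda>z. (2 * r * (z \<bullet> z) powr (r - 1)) *\<^sub>R z)
     (\<lambda>z h. (2 * r * (z \<bullet> z) powr (r - 1)) *\<^sub>R h + (2 * r * (2 * (r - 1) * (z \<bullet> z) powr (r - 2) * (z \<bullet> h))) *\<^sub>R z)"
proof -
  have der: "((\<lambda>z::'a. (z \<bullet> z) powr t) has_derivative (\<lambda>h. 2 * t * (z \<bullet> z) powr (t - 1) * (z \<bullet> h))) (at z)"
    if "z \<noteq> 0" for z :: 'a and t
    using that
    by (auto intro!: derivative_eq_intros simp: inner_commute powr_diff)
  show ?thesis
    unfolding has_hessian_def
  proof (intro conjI ballI allI)
    fix z :: 'a assume z: "z \<in> - {0}"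
    show "((\<lambda>z. (z \<bullet> z) powr r) has_derivative (\<lambda>h. (2 * r * (z \<bullet> z) powr (r - 1)) *\<^sub>R z \<bullet> h)) (at z)"
      using der[of z r] z by simp
    show "((\<lambda>z. (2 * r * (z \<bullet> z) powr (r - 1)) *\<^sub>R z) has_derivative
        (\<lambda>h. (2 * r * (z \<bullet> z) powr (r - 1)) *\<^sub>R h + (2 * r * (2 * (r - 1) * (z \<bullet> z) powr (r - 2) * (z \<bullet> h))) *\<^sub>R z)) (at z)"
      using has_derivative_scaleR[OF has_derivative_mult_right[OF der[of z "r - 1"], of "2 * r"] has_derivative_ident] z
      by simp
  next
    fix h :: 'a
    show "continuous_on (- {0}) (\<lambda>z. (2 * r * (z \<bullet> z) powr (r - 1)) *\<^sub>R h
        + (2 * r * (2 * (r - 1) * (z \<bullet> z) powr (r - 2) * (z \<bullet> h))) *\<^sub>R z)"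
      by (intro continuous_intros) auto
  qed
qed

text \<open>Kelvin transform of a homogeneous harmonic polynomial of degree \<open>N + 2\<close>; starting at degree 2 keeps
  truncated subtraction out of the second derivatives.\<close>

definition kelvin :: "'a::euclidean_space \<Rightarrow> 'a \<Rightarrow> complex \<Rightarrow> nat \<Rightarrow> 'a \<Rightarrow> real" where
  "kelvin e1 e2 c N z = Re (c * planar e1 e2 z ^ (N + 2)) * (z \<bullet> z) powr (- (real N + 1 + DIM('a) / 2))"

text \<open>Let F be the polynomial, homogeneous and harmonic of degree k = N + 2, and d the
  dimension. The Laplacian of F |z|^(2r) is 2 r F |z|^(2r-2) (d + 2 (r - 1) + 2 k): the cross term
  gives 2 k by Euler's identity, and the Laplacian of |z|^(2r) gives the rest. The bracket vanishes
  exactly for r = 1 - k - d / 2, which is the exponent in \<open>kelvin\<close>.\<close>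

lemma harmonic_on_kelvin:
  fixes e1 e2 :: "'a::euclidean_space"
  assumes e: "e1 \<in> Basis" "e2 \<in> Basis" "e1 \<noteq> e2"
  shows "harmonic_on (- {0}) (kelvin e1 e2 c N)"
proof -
  let ?w = "planar e1 e2"
  let ?r = "- (real N + 1 + DIM('a) / 2)"
  define V where "V X = Re X *\<^sub>R e2 - Im X *\<^sub>R e1" for X
  have V_inner: "V X \<bullet> h = Re (X * ?w h)" for X h
    by (simp add: V_def planar_def inner_simps inner_commute)
  have hess: "has_hessian (- {0}) (\<lambda>z. Re (c * ?w z ^ (N + 2)))
     (\<lambda>z. V (c * of_nat (N + 2) * ?w z ^ (N + 1)))
     (\<lambda>z h. V (c * of_nat (N + 2) * (of_nat (N + 1) * ?w z ^ N * ?w h)))"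
    using has_hessian_Re_planar_power[of c e1 e2 N] continuous_on_subset
    unfolding has_hessian_def V_def by blast
  have inner_sum: "(\<Sum>b\<in>Basis. (b \<bullet> x) * (b \<bullet> y)) = x \<bullet> y" for x y :: 'a
    by (subst euclidean_inner) (simp add: inner_commute)
  \<comment> \<open>The two distinct basis directions contribute 1 and i^2 = -1. This isotropy is
    what makes the real part of any power of \<open>planar\<close> harmonic in the full
    space.\<close>
  have ww: "(\<Sum>b\<in>Basis. ?w b * ?w b) = 0"
    using e by (simp add: complex_eq_iff planar_def sum_subtractf sum.distrib inner_sum)
      (auto simp: inner_Basis intro!: sum.neutral)
  have trV: "(\<Sum>b\<in>Basis. V (X * ?w b) \<bullet> b) = 0" for X
  proof -
    have "(\<Sum>b\<in>Basis. V (X * ?w b) \<bullet> b) = Re (X * (\<Sum>b\<in>Basis. ?w b * ?w b))"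
      by (simp add: V_inner Re_sum sum_distrib_left mult.assoc del: times_complex.sel)
    then show ?thesis
      by (simp add: ww)
  qed
  show ?thesis
    unfolding kelvin_def[abs_def]
  proof (rule harmonic_on_has_hessian[OF _ has_hessian_mult[OF hess has_hessian_inner_powr]])
    fix z :: 'a assume "z \<in> - {0}"
    then have zz: "0 < z \<bullet> z" by simp
    let ?f = "Re (c * ?w z ^ (N + 2))" and ?G = "V (c * of_nat (N + 2) * ?w z ^ (N + 1))"
    let ?s = "(z \<bullet> z) powr (?r - 1)" and ?t = "(z \<bullet> z) powr (?r - 2)"
    let ?Dh = "\<lambda>h. V (c * of_nat (N + 2) * (of_nat (N + 1) * ?w z ^ N * ?w h))"
    \<comment> \<open>Euler's identity for a homogeneous function of degree N + 2.\<close>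
    have Gz: "?G \<bullet> z = real (N + 2) * ?f"
    proof -
      have "?G \<bullet> z = Re (of_real (real (N + 2)) * (c * ?w z ^ (N + 2)))"
        unfolding V_inner by (simp add: ac_simps del: times_complex.sel of_nat_add)
      moreover have "Re (of_real r * x) = r * Re x" for r x by simp
      ultimately show ?thesis
        by (simp only:)
    qed
    have t: "?t * (z \<bullet> z) = ?s"
      using zz powr_add[of "z \<bullet> z" "?r - 2" 1] by simp
    have "(\<Sum>b\<in>Basis. ((?f *\<^sub>R ((2 * ?r * ?s) *\<^sub>R b + (2 * ?r * (2 * (?r - 1) * ?t * (z \<bullet> b))) *\<^sub>R z)
            + (?G \<bullet> b) *\<^sub>R ((2 * ?r * ?s) *\<^sub>R z))
          + ((z \<bullet> z) powr ?r *\<^sub>R ?Dh b + (((2 * ?r * ?s) *\<^sub>R z) \<bullet> b) *\<^sub>R ?G)) \<bullet> b)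
       = (\<Sum>b\<in>Basis. ?f * (2 * ?r * ?s) * (b \<bullet> b) + ?f * (2 * ?r * (2 * (?r - 1) * ?t)) * ((z \<bullet> b) * (z \<bullet> b))
            + 2 * (2 * ?r * ?s) * ((?G \<bullet> b) * (z \<bullet> b)) + (z \<bullet> z) powr ?r * (?Dh b \<bullet> b))"
      by (intro sum.cong refl) (simp only: inner_add_left inner_scaleR_left, simp only: algebra_simps)
    also have "\<dots> = ?f * (2 * ?r * ?s) * (\<Sum>b\<in>(Basis :: 'a set). b \<bullet> b) + ?f * (2 * ?r * (2 * (?r - 1) * ?t)) * (\<Sum>b\<in>Basis. (z \<bullet> b) * (z \<bullet> b))
            + 2 * (2 * ?r * ?s) * (\<Sum>b\<in>Basis. (?G \<bullet> b) * (z \<bullet> b)) + (z \<bullet> z) powr ?r * (\<Sum>b\<in>Basis. ?Dh b \<bullet> b)"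
      by (simp only: sum.distrib sum_distrib_left)
    also have "(\<Sum>b\<in>Basis. ?Dh b \<bullet> b) = 0"
      using trV[of "c * of_nat (N + 2) * (of_nat (N + 1) * ?w z ^ N)"] by (simp only: mult.assoc)
    also have "(\<Sum>b\<in>Basis. (?G \<bullet> b) * (z \<bullet> b)) = real (N + 2) * ?f"
      by (simp only: Gz flip: euclidean_inner)
    also have "(\<Sum>b\<in>Basis. (z \<bullet> b) * (z \<bullet> b)) = z \<bullet> z"
      by (simp only: flip: euclidean_inner)
    also have "(\<Sum>b\<in>(Basis :: 'a set). b \<bullet> b) = real DIM('a)"
      by (simp add: inner_Basis)
    also have "?f * (2 * ?r * ?s) * real DIM('a) + ?f * (2 * ?r * (2 * (?r - 1) * ?t)) * (z \<bullet> z)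
            + 2 * (2 * ?r * ?s) * (real (N + 2) * ?f) + (z \<bullet> z) powr ?r * 0
       = ?f * (2 * ?r) * (?s * DIM('a) + 2 * (?r - 1) * (?t * (z \<bullet> z)) + 2 * ?s * real (N + 2))"
      by (simp only: algebra_simps)
    also have "?s * DIM('a) + 2 * (?r - 1) * (?t * (z \<bullet> z)) + 2 * ?s * real (N + 2) = 0"
      unfolding t by (simp add: field_simps)
    finally show "(\<Sum>b\<in>Basis. ((?f *\<^sub>R ((2 * ?r * ?s) *\<^sub>R b + (2 * ?r * (2 * (?r - 1) * ?t * (z \<bullet> b))) *\<^sub>R z)
            + (?G \<bullet> b) *\<^sub>R ((2 * ?r * ?s) *\<^sub>R z))
          + ((z \<bullet> z) powr ?r *\<^sub>R ?Dh b + (((2 * ?r * ?s) *\<^sub>R z) \<bullet> b) *\<^sub>R ?G)) \<bullet> b) = 0"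
      by simp
  qed auto
qed

lemma harmonic_on_translate:
  assumes f: "harmonic_on S f" and T: "open T" "\<And>z. z \<in> T \<Longrightarrow> z - v \<in> S"
  shows "harmonic_on T (\<lambda>z. f (z - v))"
proof -
  obtain G D where GD: "\<forall>x\<in>S. (f has_derivative (\<lambda>h. G x \<bullet> h)) (at x)" "\<forall>x\<in>S. (G has_derivative D x) (at x)"
      "\<forall>h. continuous_on S (\<lambda>x. D x h)" "\<forall>x\<in>S. (\<Sum>b\<in>Basis. D x b \<bullet> b) = 0"
    using f unfolding harmonic_on_def by (elim exE conjE) (rule that)
  have shift: "((\<lambda>z. z - v) has_derivative (\<lambda>h. h)) (at z)" for z
    by (auto intro!: derivative_eq_intros)
  have "has_hessian T (\<lambda>z. f (z - v)) (\<lambda>z. G (z - v)) (\<lambda>z. D (z - v))"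
    unfolding has_hessian_def
  proof (intro conjI ballI allI)
    fix z assume "z \<in> T"
    then show "((\<lambda>z. f (z - v)) has_derivative (\<lambda>h. G (z - v) \<bullet> h)) (at z)"
      "((\<lambda>z. G (z - v)) has_derivative D (z - v)) (at z)"
      using has_derivative_compose[OF shift, of f "\<lambda>h. G (z - v) \<bullet> h" z]
        has_derivative_compose[OF shift, of G "D (z - v)" z] GD T(2) by auto
  next
    fix h
    show "continuous_on T (\<lambda>z. D (z - v) h)"
      by (rule continuous_on_compose2[OF GD(3)[rule_format, of h]]) (use T(2) in \<open>auto intro!: continuous_intros\<close>)
  qed
  then show ?thesis
    using GD(4) T by (intro harmonic_on_has_hessian[OF T(1)]) auto
qed

section \<open>Integrals over the half-space\<close>

text \<open>The factor of a horizontal coordinate in the product bound below. Translation and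
  dilation reduce it to c = 0, \<eta> = 1, which is why the constant is uniform in both; the two
  half-lines contribute 1 each.\<close>

lemma nn_integral_inverse_square:
  obtains K where "0 < K"
    "\<And>c \<eta> :: real. 0 < \<eta> \<Longrightarrow> (\<integral>\<^sup>+y. ennreal (1 / (\<bar>y - c\<bar> + \<eta>)\<^sup>2) \<partial>lborel) \<le> ennreal (K / \<eta>)"
proof -
  define K :: real where "K = 2"
  let ?g = "\<lambda>y::real. ennreal (1 / (1 + y)\<^sup>2) * indicator {0..} y"
  have g: "(\<integral>\<^sup>+y. ?g y \<partial>lborel) = ennreal (0 - (- 1 / (1 + 0)))"
  proof (rule nn_integral_FTC_atLeast)
    fix x :: real assume "0 \<le> x"
    then show "DERIV (\<lambda>x. - 1 / (1 + x)) x :> 1 / (1 + x)\<^sup>2"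
      by (auto intro!: derivative_eq_intros simp: power2_eq_square)
  next
    have "filterlim (\<lambda>x::real. 1 + x) at_top at_top"
      by (rule filterlim_tendsto_add_at_top[OF tendsto_const filterlim_ident])
    then show "((\<lambda>x::real. - 1 / (1 + x)) \<longlongrightarrow> 0) at_top"
      by (intro real_tendsto_divide_at_top) auto
  qed auto
  have "(\<integral>\<^sup>+y. ?g (- y) \<partial>lborel) = (\<integral>\<^sup>+y. ?g y \<partial>lborel)"
    by (subst (2) nn_integral_real_affine[of _ "-1" 0]) auto
  with g have "(\<integral>\<^sup>+y. ?g y \<partial>lborel) + (\<integral>\<^sup>+y. ?g (- y) \<partial>lborel) = ennreal 2"
    by (simp flip: ennreal_plus)
  moreover have "(\<integral>\<^sup>+y. ennreal (1 / (\<bar>y\<bar> + 1)\<^sup>2) \<partial>lborel) \<le> (\<integral>\<^sup>+y. ?g y + ?g (- y) \<partial>lborel)"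
    by (intro nn_integral_mono) (auto split: split_indicator simp: add.commute)
  ultimately have one: "(\<integral>\<^sup>+y. ennreal (1 / (\<bar>y\<bar> + 1)\<^sup>2) \<partial>lborel) \<le> ennreal K"
    by (simp add: nn_integral_add K_def)
  have "(\<integral>\<^sup>+y. ennreal (1 / (\<bar>y - c\<bar> + \<eta>)\<^sup>2) \<partial>lborel) \<le> ennreal (K / \<eta>)" if \<eta>: "0 < \<eta>" for c \<eta> :: real
  proof -
    have "(\<integral>\<^sup>+y. ennreal (1 / (\<bar>y - c\<bar> + \<eta>)\<^sup>2) \<partial>lborel)
        = ennreal \<eta> * (\<integral>\<^sup>+y. ennreal (1 / (\<bar>c + \<eta> * y - c\<bar> + \<eta>)\<^sup>2) \<partial>lborel)"
      using \<eta> by (subst nn_integral_real_affine[of _ \<eta> c]) auto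
    also have "(\<lambda>y. ennreal (1 / (\<bar>c + \<eta> * y - c\<bar> + \<eta>)\<^sup>2)) = (\<lambda>y. ennreal (1 / \<eta>\<^sup>2) * ennreal (1 / (\<bar>y\<bar> + 1)\<^sup>2))"
    proof
      fix y
      have "\<bar>c + \<eta> * y - c\<bar> + \<eta> = \<eta> * (\<bar>y\<bar> + 1)"
        using \<eta> by (simp add: abs_mult algebra_simps)
      then show "ennreal (1 / (\<bar>c + \<eta> * y - c\<bar> + \<eta>)\<^sup>2) = ennreal (1 / \<eta>\<^sup>2) * ennreal (1 / (\<bar>y\<bar> + 1)\<^sup>2)"
        by (simp add: power_mult_distrib flip: ennreal_mult)
    qed
    also have "ennreal \<eta> * (\<integral>\<^sup>+y. ennreal (1 / \<eta>\<^sup>2) * ennreal (1 / (\<bar>y\<bar> + 1)\<^sup>2) \<partial>lborel)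
        \<le> ennreal \<eta> * (ennreal (1 / \<eta>\<^sup>2) * ennreal K)"
      using one by (subst nn_integral_cmult) (auto intro!: mult_left_mono)
    also have "\<dots> = ennreal (K / \<eta>)"
      using \<eta> by (simp add: power2_eq_square flip: ennreal_mult')
    finally show ?thesis .
  qed
  then show ?thesis
    by (rule that[of K, rotated]) (auto simp: K_def)
qed

text \<open>The factor of the vertical coordinate. For \<eta> = 1 the integrand is dominated by y^a
  up to 1, integrable as a > -1, and by y^(a-r) beyond, integrable as r > a + 1; dilation supplies
  the power of \<eta>.\<close>

lemma nn_integral_powr_half_line:
  fixes a r :: real
  assumes a: "- 1 < a" and r: "a + 1 < r"
  obtains K where "0 < K"
    "\<And>\<eta> :: real. 0 < \<eta> \<Longrightarrow> (\<integral>\<^sup>+y. ennreal ((y + \<eta>) powr - r * y powr a) * indicator {0<..} y \<partial>lborel)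
       \<le> ennreal (K * \<eta> powr (a + 1 - r))"
proof
  let ?K = "1 / (a + 1) + 1 / (r - a - 1)"
  show "0 < ?K"
    using a r by (intro add_pos_pos) auto
  have "(\<integral>\<^sup>+y. ennreal (indicator {0..1} y * y powr a) \<partial>lborel) = ennreal (1 powr (a + 1) / (a + 1))"
    using has_integral_powr_from_0[OF a, of 1]
    by (intro nn_integral_has_integral_lebesgue) auto
  moreover have "(\<integral>\<^sup>+y. ennreal (indicator {1..} y * y powr (a - r)) \<partial>lborel) = ennreal (- (1 powr (a - r + 1)) / (a - r + 1))"
    using has_integral_powr_to_inf[of "a - r" 1] r
    by (intro nn_integral_has_integral_lebesgue) auto
  moreover have "- 1 / (a - r + 1) = 1 / (r - a - 1)"
    using r by (simp add: field_simps)
  ultimately have "(\<integral>\<^sup>+y. ennreal (indicator {0..1} y * y powr a) + ennreal (indicator {1..} y * y powr (a - r)) \<partial>lborel) = ennreal ?K"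
    using a r by (subst nn_integral_add) (auto simp flip: ennreal_plus)
  moreover have "(\<integral>\<^sup>+y. ennreal ((y + 1) powr - r * y powr a) * indicator {0<..} y \<partial>lborel)
     \<le> (\<integral>\<^sup>+y. ennreal (indicator {0..1} y * y powr a) + ennreal (indicator {1..} y * y powr (a - r)) \<partial>lborel)"
  proof (intro nn_integral_mono)
    fix y :: real
    consider "y \<le> 0" | "0 < y" "y \<le> 1" | "1 < y" by linarith
    then show "ennreal ((y + 1) powr - r * y powr a) * indicator {0<..} y
        \<le> ennreal (indicator {0..1} y * y powr a) + ennreal (indicator {1..} y * y powr (a - r))"
    proof cases
      case 2
      then have "(y + 1) powr - r * y powr a \<le> 1 * y powr a"
        using powr_mono2'[of "- r" 1 "y + 1"] a r by (intro mult_right_mono) auto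
      then show ?thesis
        using 2 by (auto intro!: ennreal_leI add_increasing2)
    next
      case 3
      then have "(y + 1) powr - r * y powr a \<le> y powr - r * y powr a"
        using powr_mono2'[of "- r" y "y + 1"] a r by (intro mult_right_mono) auto
      then show ?thesis
        using 3 by (auto intro!: ennreal_leI simp: add.commute simp flip: powr_add)
    qed auto
  qed
  ultimately have one: "(\<integral>\<^sup>+y. ennreal ((y + 1) powr - r * y powr a) * indicator {0<..} y \<partial>lborel) \<le> ennreal ?K"
    by simp
  fix \<eta> :: real assume \<eta>: "0 < \<eta>"
  have "(\<integral>\<^sup>+y. ennreal ((y + \<eta>) powr - r * y powr a) * indicator {0<..} y \<partial>lborel)
      = ennreal \<eta> * (\<integral>\<^sup>+y. ennreal ((0 + \<eta> * y + \<eta>) powr - r * (0 + \<eta> * y) powr a) * indicator {0<..} (0 + \<eta> * y) \<partial>lborel)"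
    using \<eta> by (subst nn_integral_real_affine[of _ \<eta> 0]) auto
  also have "(\<lambda>y. ennreal ((0 + \<eta> * y + \<eta>) powr - r * (0 + \<eta> * y) powr a) * indicator {0<..} (0 + \<eta> * y))
      = (\<lambda>y. ennreal (\<eta> powr (a - r)) * (ennreal ((y + 1) powr - r * y powr a) * indicator {0<..} y))"
  proof
    fix y
    have "(0 + \<eta> * y + \<eta>) powr - r * (0 + \<eta> * y) powr a = \<eta> powr (a - r) * ((y + 1) powr - r * y powr a)" if "0 < y"
    proof -
      have "0 + \<eta> * y + \<eta> = \<eta> * (y + 1)"
        by (simp add: algebra_simps)
      moreover have "\<eta> powr (a - r) = \<eta> powr - r * \<eta> powr a"
        by (simp flip: powr_add)
      ultimately show ?thesis
        using that \<eta> by (simp add: powr_mult)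
    qed
    then show "ennreal ((0 + \<eta> * y + \<eta>) powr - r * (0 + \<eta> * y) powr a) * indicator {0<..} (0 + \<eta> * y)
      = ennreal (\<eta> powr (a - r)) * (ennreal ((y + 1) powr - r * y powr a) * indicator {0<..} y)"
      using \<eta> by (auto split: split_indicator simp: zero_less_mult_iff simp flip: ennreal_mult)
  qed
  also have "ennreal \<eta> * (\<integral>\<^sup>+y. ennreal (\<eta> powr (a - r)) * (ennreal ((y + 1) powr - r * y powr a) * indicator {0<..} y) \<partial>lborel)
      \<le> ennreal \<eta> * (ennreal (\<eta> powr (a - r)) * ennreal ?K)"
    using one by (subst nn_integral_cmult) (auto intro!: mult_left_mono)
  also have "\<dots> = ennreal (?K * \<eta> powr (a + 1 - r))"
  proof -
    have "\<eta> * (\<eta> powr (a - r) * ?K) = ?K * \<eta> powr (a + 1 - r)"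
      using \<eta> powr_add[of \<eta> 1 "a - r"] by (simp add: algebra_simps)
    then show ?thesis
      using \<eta> \<open>0 < ?K\<close> by (simp flip: ennreal_mult)
  qed
  finally show "(\<integral>\<^sup>+y. ennreal ((y + \<eta>) powr - r * y powr a) * indicator {0<..} y \<partial>lborel)
       \<le> ennreal (?K * \<eta> powr (a + 1 - r))" .
qed

lemma prod_mono_ennreal:
  fixes f g :: "'a \<Rightarrow> ennreal"
  assumes "\<And>i. i \<in> A \<Longrightarrow> f i \<le> g i"
  shows "prod f A \<le> prod g A"
  using assms by (induction A rule: infinite_finite_induct) (auto intro: mult_mono)

lemma prod_Basis_vec_real:
  fixes h :: "(real ^ 'n) \<times> real \<Rightarrow> 'b::comm_monoid_mult"
  shows "(\<Prod>b\<in>Basis. h b) = h (0, 1) * (\<Prod>u\<in>Basis. h (u, 0))"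
proof -
  have "(\<Prod>b\<in>Basis. h b) = (\<Prod>b\<in>(\<lambda>u. (u, 0)) ` Basis. h b) * (\<Prod>b\<in>{(0, 1)}. h b)"
    unfolding Basis_prod_def by (subst prod.union_disjoint) auto
  also have "(\<Prod>b\<in>(\<lambda>u. (u, 0)) ` Basis. h b) = (\<Prod>u\<in>Basis. h (u, 0))"
    by (subst prod.reindex) (auto simp: inj_on_def)
  finally show ?thesis
    by (simp add: mult.commute)
qed

text \<open>The norm is at least t + \<eta>, and at least half of |x_u - \<xi>_u| + \<eta> for each
  horizontal coordinate u. Spending exponent 2 on each of the n horizontal coordinates (whence 4^n)
  and the rest A = \<beta> - 2n on the vertical one dominates the integrand by a product, to which
  Tonelli's theorem applies. The hypothesis on \<beta> says that A >= \<alpha> + 2. The domination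
  is crude, but it scales exactly: (\<alpha> + 1 - A) - n = n + 1 + \<alpha> - \<beta>.\<close>

lemma nn_integral_norm_powr_half_space:
  fixes \<alpha> \<beta> :: real
  assumes \<alpha>: "- 1 < \<alpha>" and \<beta>: "2 * real CARD('n) + \<alpha> + 2 \<le> \<beta>"
  obtains K where "0 < K"
    "\<And>(\<xi> :: real ^ 'n) \<eta>. 0 < \<eta> \<Longrightarrow>
       (\<integral>\<^sup>+z\<in>half_space. ennreal (norm (z - (\<xi>, - \<eta>)) powr - \<beta> * snd z powr \<alpha>) \<partial>lborel)
         \<le> ennreal (K * \<eta> powr (real CARD('n) + 1 + \<alpha> - \<beta>))"
proof -
  let ?n = "CARD('n)"
  define A where "A = \<beta> - 2 * real ?n"
  have A: "\<alpha> + 1 < A" "0 < A" using \<alpha> \<beta> by (auto simp: A_def)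
  obtain K1 where K1: "0 < K1" "\<And>c \<eta> :: real. 0 < \<eta> \<Longrightarrow> (\<integral>\<^sup>+y. ennreal (1 / (\<bar>y - c\<bar> + \<eta>)\<^sup>2) \<partial>lborel) \<le> ennreal (K1 / \<eta>)"
    by (rule nn_integral_inverse_square) blast
  obtain K2 where K2: "0 < K2"
    "\<And>\<eta> :: real. 0 < \<eta> \<Longrightarrow> (\<integral>\<^sup>+y. ennreal ((y + \<eta>) powr - A * y powr \<alpha>) * indicator {0<..} y \<partial>lborel)
       \<le> ennreal (K2 * \<eta> powr (\<alpha> + 1 - A))"
    using nn_integral_powr_half_line[OF \<alpha> A(1)] by blast
  define K where "K = 4 ^ ?n * (K2 * K1 ^ ?n)"
  have "(\<integral>\<^sup>+z\<in>half_space. ennreal (norm (z - (\<xi>, - \<eta>)) powr - \<beta> * snd z powr \<alpha>) \<partial>lborel)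
         \<le> ennreal (K * \<eta> powr (real ?n + 1 + \<alpha> - \<beta>))"
    if \<eta>: "0 < \<eta>" for \<xi> :: "real ^ 'n" and \<eta> :: real
  proof -
    define f :: "(real ^ 'n) \<times> real \<Rightarrow> real \<Rightarrow> ennreal" where
      "f b y = (if b = (0, 1) then ennreal ((y + \<eta>) powr - A * y powr \<alpha>) * indicator {0<..} y
        else ennreal (1 / (\<bar>y - \<xi> \<bullet> fst b\<bar> + \<eta>)\<^sup>2))" for b y
    have f_meas: "f b \<in> borel_measurable borel" for b
      unfolding f_def[abs_def] by (cases "b = (0, 1)") simp_all
    have "(\<integral>\<^sup>+z\<in>half_space. ennreal (norm (z - (\<xi>, - \<eta>)) powr - \<beta> * snd z powr \<alpha>) \<partial>lborel)
        \<le> (\<integral>\<^sup>+z. ennreal (4 ^ ?n) * (\<Prod>b\<in>Basis. f b (z \<bullet> b)) \<partial>lborel)"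
    proof (intro nn_integral_mono)
      fix z :: "(real ^ 'n) \<times> real"
      show "ennreal (norm (z - (\<xi>, - \<eta>)) powr - \<beta> * snd z powr \<alpha>) * indicator half_space z
          \<le> ennreal (4 ^ ?n) * (\<Prod>b\<in>Basis. f b (z \<bullet> b))"
      proof (cases "z \<in> half_space")
        case True
        obtain x t where z: "z = (x, t)" by (cases z)
        have t: "0 < t" using True by (simp add: half_space_def z)
        let ?N = "norm (z - (\<xi>, - \<eta>))"
        have N1: "t + \<eta> \<le> ?N"
          using norm_snd_le[of "t + \<eta>" "x - \<xi>"] t \<eta> by (simp add: z)
        then have N0: "0 < ?N" using t \<eta> by linarith
        have N2: "(\<bar>x \<bullet> u - \<xi> \<bullet> u\<bar> + \<eta>) / 2 \<le> ?N" if "u \<in> Basis" for u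
        proof -
          have "\<bar>(x - \<xi>) \<bullet> u\<bar> \<le> norm (x - \<xi>)"
            using that by (rule Basis_le_norm)
          also have "\<dots> \<le> ?N"
            using norm_fst_le[of "x - \<xi>" "t + \<eta>"] by (simp add: z)
          finally show ?thesis
            using N1 t by (simp add: inner_diff_left)
        qed
        have inv: "?N powr - 2 \<le> 4 * (1 / (\<bar>x \<bullet> u - \<xi> \<bullet> u\<bar> + \<eta>)\<^sup>2)" if "u \<in> Basis" for u
        proof -
          have "?N powr - 2 \<le> ((\<bar>x \<bullet> u - \<xi> \<bullet> u\<bar> + \<eta>) / 2) powr - 2"
            using \<eta> by (intro powr_mono2' N2 that) auto
          also have "\<dots> = 4 * (1 / (\<bar>x \<bullet> u - \<xi> \<bullet> u\<bar> + \<eta>)\<^sup>2)"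
            using \<eta> by (simp add: powr_minus power_divide field_simps)
          finally show ?thesis .
        qed
        have "?N powr - \<beta> = ?N powr - A * (\<Prod>u\<in>(Basis :: (real ^ 'n) set). ?N powr - 2)"
          using N0 by (simp add: A_def powr_powr powr_add[symmetric] flip: powr_realpow)
        also have "\<dots> \<le> (t + \<eta>) powr - A * (\<Prod>u\<in>Basis. 4 * (1 / (\<bar>x \<bullet> u - \<xi> \<bullet> u\<bar> + \<eta>)\<^sup>2))"
          using t \<eta> A N1 inv by (intro mult_mono powr_mono2' prod_mono prod_nonneg) auto
        finally have "?N powr - \<beta> * t powr \<alpha>
            \<le> (t + \<eta>) powr - A * (\<Prod>u\<in>Basis. 4 * (1 / (\<bar>x \<bullet> u - \<xi> \<bullet> u\<bar> + \<eta>)\<^sup>2)) * t powr \<alpha>"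
          by (rule mult_right_mono) simp
        also have "\<dots> = 4 ^ ?n * (((t + \<eta>) powr - A * t powr \<alpha>) * (\<Prod>u\<in>Basis. 1 / (\<bar>x \<bullet> u - \<xi> \<bullet> u\<bar> + \<eta>)\<^sup>2))"
          unfolding prod.distrib by simp
        finally have "ennreal (?N powr - \<beta> * t powr \<alpha>)
            \<le> ennreal (4 ^ ?n * (((t + \<eta>) powr - A * t powr \<alpha>) * (\<Prod>u\<in>Basis. 1 / (\<bar>x \<bullet> u - \<xi> \<bullet> u\<bar> + \<eta>)\<^sup>2)))"
          by (rule ennreal_leI)
        also have "\<dots> = ennreal (4 ^ ?n) * (ennreal ((t + \<eta>) powr - A * t powr \<alpha>) * (\<Prod>u\<in>Basis. ennreal (1 / (\<bar>x \<bullet> u - \<xi> \<bullet> u\<bar> + \<eta>)\<^sup>2)))"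
          by (subst prod_ennreal) (auto simp: ennreal_mult prod_nonneg)
        also have "\<dots> = ennreal (4 ^ ?n) * (\<Prod>b\<in>Basis. f b (z \<bullet> b))"
          unfolding prod_Basis_vec_real using t by (simp add: f_def z)
        finally show ?thesis
          using True by (simp add: z)
      qed simp
    qed
    also have "\<dots> = ennreal (4 ^ ?n) * (\<integral>\<^sup>+z. (\<Prod>b\<in>Basis. f b (z \<bullet> b)) \<partial>lborel)"
      by (intro nn_integral_cmult borel_measurable_prod_ennreal measurable_compose[OF _ f_meas]) simp
    also have "(\<integral>\<^sup>+z. (\<Prod>b\<in>Basis. f b (z \<bullet> b)) \<partial>lborel) = (\<Prod>b\<in>Basis. (\<integral>\<^sup>+y. f b y \<partial>lborel))"
      using f_meas by (intro nn_integral_lborel_prod) auto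
    also have "\<dots> = (\<integral>\<^sup>+y. ennreal ((y + \<eta>) powr - A * y powr \<alpha>) * indicator {0<..} y \<partial>lborel)
        * (\<Prod>u\<in>Basis. (\<integral>\<^sup>+y. ennreal (1 / (\<bar>y - \<xi> \<bullet> u\<bar> + \<eta>)\<^sup>2) \<partial>lborel))"
      unfolding prod_Basis_vec_real by (simp add: f_def[abs_def])
    also have "\<dots> \<le> ennreal (K2 * \<eta> powr (\<alpha> + 1 - A)) * (\<Prod>u\<in>(Basis :: (real ^ 'n) set). ennreal (K1 / \<eta>))"
      using K1(2)[OF \<eta>] K2(2)[OF \<eta>] by (intro mult_mono prod_mono_ennreal) auto
    also have "ennreal (4 ^ ?n) * (ennreal (K2 * \<eta> powr (\<alpha> + 1 - A)) * (\<Prod>u\<in>(Basis :: (real ^ 'n) set). ennreal (K1 / \<eta>)))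
        = ennreal (4 ^ ?n * (K2 * \<eta> powr (\<alpha> + 1 - A) * (K1 / \<eta>) ^ ?n))"
      using K1 K2 \<eta> by (simp add: ennreal_mult ennreal_power)
    also have "4 ^ ?n * (K2 * \<eta> powr (\<alpha> + 1 - A) * (K1 / \<eta>) ^ ?n) = K * \<eta> powr (real ?n + 1 + \<alpha> - \<beta>)"
    proof -
      have eq: "\<eta> powr (\<alpha> + 1 - A) / \<eta> ^ ?n = \<eta> powr (real ?n + 1 + \<alpha> - \<beta>)"
        using \<eta> by (simp add: A_def algebra_simps flip: powr_realpow powr_diff)
      show ?thesis
        unfolding eq[symmetric] K_def power_divide by (simp add: ac_simps)
    qed
    finally show ?thesis
      by (simp add: mult_left_mono)
  qed
  moreover have "0 < K"
    using K1 K2 by (simp add: K_def)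
  ultimately show ?thesis
    using that by blast
qed

section \<open>Size of the test functions\<close>

lemma cmod_planar_le_norm:
  assumes "e1 \<in> Basis" "e2 \<in> Basis" "e1 \<noteq> e2"
  shows "cmod (planar e1 e2 z) \<le> norm z"
proof -
  have "(z \<bullet> e2)\<^sup>2 + (z \<bullet> e1)\<^sup>2 = (\<Sum>b\<in>{e1, e2}. (z \<bullet> b)\<^sup>2)"
    using assms by simp
  also have "\<dots> \<le> (\<Sum>b\<in>Basis. (z \<bullet> b)\<^sup>2)"
    using assms by (intro sum_mono2) auto
  also have "\<dots> = z \<bullet> z"
    by (simp add: euclidean_inner[of z z] power2_eq_square)
  finally show ?thesis
    by (simp add: planar_def cmod_def norm_eq_sqrt_inner)
qed

lemma inner_powr_eq_norm_powr: "(z \<bullet> z) powr r = norm z powr (2 * r)"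
proof (cases "z = 0")
  case False
  then have "z \<bullet> z = norm z powr 2"
    by (simp add: dot_square_norm)
  then show ?thesis
    by (simp only: powr_powr)
qed simp

text \<open>The numerator is at most |z|^(N+2), and N + 2 - (2N + 2 + d) = -(N + d). At the pole
  both sides are 0, since \<open>0 powr r = 0\<close> also for negative r.\<close>

lemma abs_kelvin_le:
  fixes e1 e2 :: "'a::euclidean_space"
  assumes "e1 \<in> Basis" "e2 \<in> Basis" "e1 \<noteq> e2" and c: "cmod c = 1"
  shows "\<bar>kelvin e1 e2 c N z\<bar> \<le> norm z powr - (real N + real DIM('a))"
proof (cases "z = 0")
  case True
  then show ?thesis by (simp add: kelvin_def)
next
  case False
  have "\<bar>Re (c * planar e1 e2 z ^ (N + 2))\<bar> \<le> cmod (c * planar e1 e2 z ^ (N + 2))"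
    by (rule abs_Re_le_cmod)
  also have "\<dots> \<le> norm z ^ (N + 2)"
    unfolding norm_mult norm_power c mult_1_left by (intro power_mono cmod_planar_le_norm assms) simp
  finally have "\<bar>kelvin e1 e2 c N z\<bar> \<le> norm z ^ (N + 2) * norm z powr (2 * - (real N + 1 + DIM('a) / 2))"
    unfolding kelvin_def abs_mult inner_powr_eq_norm_powr by (simp add: mult_right_mono del: power_Suc)
  also have "\<dots> = norm z powr (real (N + 2) + 2 * - (real N + 1 + DIM('a) / 2))"
  proof -
    have "norm z ^ (N + 2) = norm z powr real (N + 2)"
      using False by (subst powr_realpow) auto
    then show ?thesis
      by (simp only: powr_add)
  qed
  also have "real (N + 2) + 2 * - (real N + 1 + DIM('a) / 2) = - (real N + real DIM('a))"
    by simp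
  finally show ?thesis .
qed

text \<open>The real part of the polynomial may vanish inside a cube; the choices \<open>c = 1\<close> and \<open>c = - \<i>\<close> give the
  real and the imaginary part, which do not vanish simultaneously.\<close>

lemma kelvin_powr_ge:
  fixes e1 e2 :: "'a::euclidean_space"
  assumes P: "0 < P" and a: "0 < a" "a \<le> cmod (planar e1 e2 z)" and b: "norm z \<le> b"
  shows "(a ^ (N + 2) / 2 * b powr (- (2 * real N + 2 + DIM('a)))) powr P
     \<le> \<bar>kelvin e1 e2 1 N z\<bar> powr P + \<bar>kelvin e1 e2 (- \<i>) N z\<bar> powr P"
proof -
  let ?w = "planar e1 e2 z ^ (N + 2)"
  let ?Q = "(z \<bullet> z) powr (- (real N + 1 + DIM('a) / 2))"
  have "z \<noteq> 0"
    using a by (auto simp: planar_def cmod_def)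
  have "a ^ (N + 2) \<le> cmod ?w"
    unfolding norm_power using a by (intro power_mono) auto
  also have "\<dots> \<le> \<bar>Re ?w\<bar> + \<bar>Im ?w\<bar>"
    by (rule cmod_le)
  finally have w: "a ^ (N + 2) / 2 \<le> max \<bar>Re ?w\<bar> \<bar>Im ?w\<bar>"
    by linarith
  have e: "- (2 * real N + 2 + DIM('a)) = 2 * (- (real N + 1 + DIM('a) / 2))"
    by simp
  have Q: "b powr (- (2 * real N + 2 + DIM('a))) \<le> ?Q"
    unfolding e inner_powr_eq_norm_powr using \<open>z \<noteq> 0\<close> b by (intro powr_mono2') auto
  have "a ^ (N + 2) / 2 * b powr (- (2 * real N + 2 + DIM('a))) \<le> max \<bar>Re ?w\<bar> \<bar>Im ?w\<bar> * ?Q"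
    using a by (intro mult_mono w Q) auto
  also have "\<dots> = max \<bar>kelvin e1 e2 1 N z\<bar> \<bar>kelvin e1 e2 (- \<i>) N z\<bar>"
    by (simp add: kelvin_def abs_mult max_mult_distrib_right del: power_Suc)
  finally have "(a ^ (N + 2) / 2 * b powr (- (2 * real N + 2 + DIM('a)))) powr P
      \<le> max \<bar>kelvin e1 e2 1 N z\<bar> \<bar>kelvin e1 e2 (- \<i>) N z\<bar> powr P"
    using P a by (intro powr_mono2) auto
  also have "\<dots> \<le> \<bar>kelvin e1 e2 1 N z\<bar> powr P + \<bar>kelvin e1 e2 (- \<i>) N z\<bar> powr P"
    by (simp add: max_def)
  finally show ?thesis .
qed

section \<open>Geometry of Whitney cubes\<close>

lemma mem_cube: "z \<in> cube c s \<longleftrightarrow> (\<forall>b\<in>Basis. \<bar>(z - c) \<bullet> b\<bar> \<le> s / 2)"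
proof -
  have "((c - (s / 2) *\<^sub>R One) \<bullet> b \<le> z \<bullet> b \<and> z \<bullet> b \<le> (c + (s / 2) *\<^sub>R One) \<bullet> b) \<longleftrightarrow> \<bar>(z - c) \<bullet> b\<bar> \<le> s / 2"
    if "b \<in> Basis" for b
  proof -
    have "One \<bullet> b = 1"
      using that by simp
    then show ?thesis
      unfolding inner_diff_left inner_add_left inner_scaleR_left by (smt (verit) mult_cancel_left2)
  qed
  then show ?thesis
    unfolding cube_def mem_box by blast
qed

lemma measure_cube:
  fixes c :: "'a::euclidean_space"
  assumes "0 \<le> s"
  shows "measure lborel (cube c s) = s ^ DIM('a)"
proof -
  have "measure lborel (cube c s) = (\<Prod>b\<in>Basis. (c + (s / 2) *\<^sub>R One) \<bullet> b - (c - (s / 2) *\<^sub>R One) \<bullet> b)"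
    unfolding cube_def using assms by (intro content_cbox) (simp add: inner_simps)
  also have "\<dots> = (\<Prod>b\<in>(Basis :: 'a set). s)"
    by (intro prod.cong) (simp_all add: inner_simps)
  finally show ?thesis by simp
qed

text \<open>Enlarging 5/4 times moves every face outwards by 5s/8 - s/2 = s/8.\<close>

lemma cball_subset_enlarged_cube:
  assumes "z \<in> cube c s"
  shows "cball z (s / 8) \<subseteq> enlarged_cube c s"
proof
  fix y assume "y \<in> cball z (s / 8)"
  show "y \<in> enlarged_cube c s"
    unfolding enlarged_cube_def mem_cube
  proof
    fix b :: 'a assume b: "b \<in> Basis"
    have "\<bar>(y - z) \<bullet> b\<bar> \<le> s / 8"
      using Basis_le_norm[OF b, of "y - z"] \<open>y \<in> cball z (s / 8)\<close> by (simp add: dist_norm norm_minus_commute)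
    moreover have "\<bar>(z - c) \<bullet> b\<bar> \<le> s / 2"
      using assms b by (simp add: mem_cube)
    ultimately show "\<bar>(y - c) \<bullet> b\<bar> \<le> 5 / 4 * s / 2"
      unfolding inner_diff_left by linarith
  qed
qed

lemma norm_le_if_mem_cube:
  fixes c :: "'a::euclidean_space"
  assumes "z \<in> cube c s"
  shows "norm (z - c) \<le> real DIM('a) * (s / 2)"
proof -
  have "norm (z - c) \<le> (\<Sum>b\<in>Basis. \<bar>(z - c) \<bullet> b\<bar>)"
    by (rule norm_le_l1)
  also have "\<dots> \<le> real DIM('a) * (s / 2)"
    using assms sum_bounded_above[of Basis "\<lambda>b. \<bar>(z - c) \<bullet> b\<bar>" "s / 2"] by (simp add: mem_cube)
  finally show ?thesis .
qed

lemma open_half_space: "open half_space"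
  unfolding half_space_def by (intro open_Collect_less continuous_intros)

lemma frontier_half_space_snd:
  fixes w :: "(real ^ 'n) \<times> real"
  assumes w: "w \<in> frontier half_space"
  shows "snd w = 0"
proof -
  from w have "w \<notin> half_space"
    by (simp add: frontier_def interior_open[OF open_half_space])
  moreover have "closure half_space \<subseteq> {z :: (real ^ 'n) \<times> real. 0 \<le> snd z}"
    by (intro closure_minimal closed_Collect_le continuous_intros) (auto simp: half_space_def)
  with w have "0 \<le> snd w"
    by (auto simp: frontier_def)
  ultimately show ?thesis
    by (simp add: half_space_def)
qed

lemma frontier_half_space_nonempty: "frontier (half_space :: ((real ^ 'n) \<times> real) set) \<noteq> {}"
proof -
  have "(0, 1) \<in> (half_space :: ((real ^ 'n) \<times> real) set)" "(0, 0) \<notin> (half_space :: ((real ^ 'n) \<times> real) set)"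
    by (auto simp: half_space_def)
  then show ?thesis
    unfolding frontier_eq_empty by blast
qed

text \<open>The point 5s/8 below the center belongs to the enlarged cube, hence to the half-space,
  which bounds the side by the height. Conversely the distance from the cube to the boundary is at
  least \<eta> - s/2, while c times this distance is at most the diameter, hence at most d s with d
  = n + 1; this gives L = 1/2 + d / c.\<close>

lemma whitney_side_comparable:
  fixes \<zeta> :: "nat \<Rightarrow> (real ^ 'n) \<times> real"
  assumes W: "whitney_decomposition \<zeta> s" and E: "whitney_enlargement \<zeta> s"
  obtains L where "0 < L" "\<And>k. 0 < s k" "\<And>k. 0 < snd (\<zeta> k)" "\<And>k. s k \<le> 2 * snd (\<zeta> k)"
    "\<And>k. snd (\<zeta> k) \<le> L * s k"
proof -
  have s: "0 < s k" for k
    using W by (simp add: whitney_decomposition_def)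
  have s_le: "s k \<le> 2 * snd (\<zeta> k)" for k
  proof -
    have "\<zeta> k - (5 / 8 * s k) *\<^sub>R (0, 1) \<in> enlarged_cube (\<zeta> k) (s k)"
      using s[of k] by (auto simp: enlarged_cube_def mem_cube Basis_prod_def)
    then have "\<zeta> k - (5 / 8 * s k) *\<^sub>R (0, 1) \<in> half_space"
      using E by (auto simp: whitney_enlargement_def)
    then show ?thesis
      using s[of k] by (simp add: half_space_def)
  qed
  obtain c where c: "0 < c"
    and cC: "\<exists>C>0. \<forall>k. c * setdist (cube (\<zeta> k) (s k)) (frontier half_space) \<le> diameter (cube (\<zeta> k) (s k)) \<and>
      diameter (cube (\<zeta> k) (s k)) \<le> C * setdist (cube (\<zeta> k) (s k)) (frontier half_space)"
    using W unfolding whitney_decomposition_def by (elim conjE exE) (rule that; blast)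
  have c_diam: "c * setdist (cube (\<zeta> k) (s k)) (frontier half_space) \<le> diameter (cube (\<zeta> k) (s k))" for k
    using cC by blast
  let ?d = "real DIM((real ^ 'n) \<times> real)"
  have "snd (\<zeta> k) \<le> (1 / 2 + ?d / c) * s k" for k
  proof -
    have self: "\<zeta> k \<in> cube (\<zeta> k) (s k)"
      using s[of k] by (simp add: mem_cube)
    have "snd (\<zeta> k) - s k / 2 \<le> setdist (cube (\<zeta> k) (s k)) (frontier half_space)"
    proof (rule le_setdistI)
      fix z w assume z: "z \<in> cube (\<zeta> k) (s k)" and w: "w \<in> frontier (half_space :: ((real ^ 'n) \<times> real) set)"
      have "\<bar>(z - \<zeta> k) \<bullet> (0, 1)\<bar> \<le> s k / 2"
        using z unfolding mem_cube by (rule bspec) (simp add: Basis_prod_def)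
      moreover have "\<bar>snd z - snd w\<bar> \<le> dist z w"
        using dist_snd_le[of z w] by (simp add: dist_real_def)
      ultimately show "snd (\<zeta> k) - s k / 2 \<le> dist z w"
        using frontier_half_space_snd[OF w] by (simp add: inner_prod_def) (smt (verit) field_sum_of_halves)
    qed (use self frontier_half_space_nonempty in auto)
    then have "c * (snd (\<zeta> k) - s k / 2) \<le> c * setdist (cube (\<zeta> k) (s k)) (frontier half_space)"
      using c by simp
    also have "\<dots> \<le> diameter (cube (\<zeta> k) (s k))"
      by (rule c_diam)
    also have "\<dots> \<le> ?d * s k"
    proof (rule diameter_le)
      fix x y assume "x \<in> cube (\<zeta> k) (s k)" "y \<in> cube (\<zeta> k) (s k)"
      then show "norm (x - y) \<le> ?d * s k"
        using norm_triangle_ineq4[of "x - \<zeta> k" "y - \<zeta> k"] norm_le_if_mem_cube[of x "\<zeta> k" "s k"]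
          norm_le_if_mem_cube[of y "\<zeta> k" "s k"] by simp
    qed (use self in auto)
    finally show ?thesis
      using c by (simp add: field_simps)
  qed
  moreover have "0 < 1 / 2 + ?d / c"
    using c by (intro add_pos_nonneg) auto
  moreover have "0 < snd (\<zeta> k)" for k
    using s[of k] s_le[of k] by simp
  ultimately show ?thesis
    using that s s_le by blast
qed

text \<open>The local bound is used on the ball of radius s/8 about z, which lies in the enlarged
  cube; it contributes s^(-(n+1)). There the weight t^\<alpha> is comparable to s^\<alpha>, so
  inserting it costs s^(-\<alpha>).\<close>

lemma harmonic_powr_le_on_cube:
  fixes \<zeta> :: "nat \<Rightarrow> (real ^ 'n) \<times> real" and p \<alpha> :: real
  assumes W: "whitney_decomposition \<zeta> s" and E: "whitney_enlargement \<zeta> s" and p: "0 < p"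
  obtains C where "0 < C"
    "\<And>f k z. harmonic_on half_space f \<Longrightarrow> z \<in> cube (\<zeta> k) (s k) \<Longrightarrow>
       ennreal (\<bar>f z\<bar> powr p) \<le> ennreal (C * s k powr - (real CARD('n) + 1 + \<alpha>)) *
         (\<integral>\<^sup>+z\<in>enlarged_cube (\<zeta> k) (s k). ennreal (\<bar>f z\<bar> powr p * snd z powr \<alpha>) \<partial>lborel)"
proof -
  let ?n = "real CARD('n) + 1"
  have DIM: "DIM((real ^ 'n) \<times> real) = CARD('n) + 1"
    by simp
  obtain L where L: "0 < L" and s: "\<And>k. 0 < s k" and \<eta>: "\<And>k. 0 < snd (\<zeta> k)"
    and s\<eta>: "\<And>k. s k \<le> 2 * snd (\<zeta> k)" "\<And>k. snd (\<zeta> k) \<le> L * s k"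
    using whitney_side_comparable[OF W E] by blast
  obtain c1 c2 where c: "0 < c1" "0 < c2"
    and t: "\<And>k z. z \<in> enlarged_cube (\<zeta> k) (s k) \<Longrightarrow> c1 * snd (\<zeta> k) \<le> snd z \<and> snd z \<le> c2 * snd (\<zeta> k)"
    and sub: "\<And>k. enlarged_cube (\<zeta> k) (s k) \<subseteq> half_space"
    using E unfolding whitney_enlargement_def by blast
  obtain C0 where C0: "0 < C0"
    "\<And>(f :: (real ^ 'n) \<times> real \<Rightarrow> real) S z R. harmonic_on S f \<Longrightarrow> 0 < R \<Longrightarrow> cball z R \<subseteq> S \<Longrightarrow>
       ennreal (\<bar>f z\<bar> powr p * R ^ DIM((real ^ 'n) \<times> real))
         \<le> ennreal C0 * (\<integral>\<^sup>+x\<in>cball z R. ennreal (\<bar>f x\<bar> powr p) \<partial>lborel)"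
    using harmonic_powr_le_nn_integral[OF p] by blast
  \<comment> \<open>The quotient t / s ranges over [c1 / 2, c2 L], and its power \<alpha> is
    smallest at one end or the other according to the sign of \<alpha>.\<close>
  define m where "m = min ((c1 / 2) powr \<alpha>) ((c2 * L) powr \<alpha>)"
  have m: "0 < m"
    using c L by (simp add: m_def)
  have weight: "1 \<le> 1 / m * s k powr - \<alpha> * snd z powr \<alpha>" if z: "z \<in> enlarged_cube (\<zeta> k) (s k)" for z k
  proof -
    have "c1 / 2 * s k \<le> c1 * snd (\<zeta> k)" "c2 * snd (\<zeta> k) \<le> c2 * (L * s k)"
      using c s\<eta>[of k] by auto
    with t[OF z] have u: "c1 / 2 * s k \<le> snd z" "snd z \<le> c2 * L * s k"
      by auto
    define v where "v = snd z / s k"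
    have v: "c1 / 2 \<le> v" "v \<le> c2 * L"
      using u s[of k] by (auto simp: v_def field_simps)
    have "m \<le> v powr \<alpha>"
    proof (cases "0 \<le> \<alpha>")
      case True
      then have "(c1 / 2) powr \<alpha> \<le> v powr \<alpha>"
        using v c by (intro powr_mono2) auto
      then show ?thesis by (simp add: m_def)
    next
      case False
      then have "(c2 * L) powr \<alpha> \<le> v powr \<alpha>"
        using v c by (intro powr_mono2') auto
      then show ?thesis by (simp add: m_def)
    qed
    also have "v powr \<alpha> = s k powr - \<alpha> * snd z powr \<alpha>"
      using s[of k] v c by (simp add: v_def powr_divide powr_minus field_simps zero_le_divide_iff)
    finally show ?thesis
      using m by (simp add: field_simps)
  qed
  define C where "C = 8 ^ DIM((real ^ 'n) \<times> real) * C0 / m"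
  have "ennreal (\<bar>f z\<bar> powr p) \<le> ennreal (C * s k powr - (?n + \<alpha>)) *
         (\<integral>\<^sup>+z\<in>enlarged_cube (\<zeta> k) (s k). ennreal (\<bar>f z\<bar> powr p * snd z powr \<alpha>) \<partial>lborel)"
    if f: "harmonic_on half_space f" and z: "z \<in> cube (\<zeta> k) (s k)" for f k z
  proof -
    let ?E = "enlarged_cube (\<zeta> k) (s k)"
    let ?J = "\<integral>\<^sup>+x\<in>?E. ennreal (\<bar>f x\<bar> powr p * snd x powr \<alpha>) \<partial>lborel"
    have cb: "cball z (s k / 8) \<subseteq> ?E"
      using z by (rule cball_subset_enlarged_cube)
    have E_borel: "?E \<in> sets borel"
      by (simp add: enlarged_cube_def cube_def)
    have cont: "continuous_on ?E f"
      using harmonic_on_continuous_on[OF f] sub continuous_on_subset by blast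
    \<comment> \<open>Off the half-space f is arbitrary and perhaps not measurable, so f is first
      cut off by the indicator, which does not change the integrand.\<close>
    have meas: "(\<lambda>x. ennreal (\<bar>f x\<bar> powr p * snd x powr \<alpha>) * indicator ?E x) \<in> borel_measurable lborel"
    proof -
      note [measurable] = E_borel borel_measurable_continuous_on_indicator[OF E_borel cont]
      have [measurable]: "snd \<in> borel_measurable (borel :: ((real ^ 'n) \<times> real) measure)"
        by (intro borel_measurable_continuous_onI continuous_intros)
      have "(\<lambda>x. ennreal (\<bar>indicator ?E x *\<^sub>R f x\<bar> powr p * snd x powr \<alpha>) * indicator ?E x) \<in> borel_measurable borel"
        by measurable
      also have "(\<lambda>x. ennreal (\<bar>indicator ?E x *\<^sub>R f x\<bar> powr p * snd x powr \<alpha>) * indicator ?E x)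
          = (\<lambda>x. ennreal (\<bar>f x\<bar> powr p * snd x powr \<alpha>) * indicator ?E x)"
        by (auto simp: fun_eq_iff split: split_indicator)
      finally show ?thesis by simp
    qed
    have "ennreal (\<bar>f z\<bar> powr p * (s k / 8) ^ DIM((real ^ 'n) \<times> real))
        \<le> ennreal C0 * (\<integral>\<^sup>+x\<in>cball z (s k / 8). ennreal (\<bar>f x\<bar> powr p) \<partial>lborel)"
      using s[of k] cb sub[of k] by (intro C0(2)[OF f]) auto
    also have "\<dots> \<le> ennreal C0 * (\<integral>\<^sup>+x. ennreal (1 / m * s k powr - \<alpha>) *
          (ennreal (\<bar>f x\<bar> powr p * snd x powr \<alpha>) * indicator ?E x) \<partial>lborel)"
    proof (intro mult_left_mono nn_integral_mono)
      fix x
      show "ennreal (\<bar>f x\<bar> powr p) * indicator (cball z (s k / 8)) x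
          \<le> ennreal (1 / m * s k powr - \<alpha>) * (ennreal (\<bar>f x\<bar> powr p * snd x powr \<alpha>) * indicator ?E x)"
      proof (cases "x \<in> ?E")
        case True
        have "\<bar>f x\<bar> powr p \<le> 1 / m * s k powr - \<alpha> * (\<bar>f x\<bar> powr p * snd x powr \<alpha>)"
          using mult_right_mono[OF weight[OF True], of "\<bar>f x\<bar> powr p"] by (simp add: ac_simps)
        then have "ennreal (\<bar>f x\<bar> powr p) \<le> ennreal (1 / m * s k powr - \<alpha>) * ennreal (\<bar>f x\<bar> powr p * snd x powr \<alpha>)"
          using m by (simp add: ennreal_leI flip: ennreal_mult)
        then show ?thesis
          using True by (auto split: split_indicator)
      next
        case False
        then show ?thesis
          using cb by (auto split: split_indicator)
      qed
    qed simp
    also have "\<dots> = ennreal (C0 * (1 / m * s k powr - \<alpha>)) * ?J"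
      using C0(1) m by (subst nn_integral_cmult[OF meas], subst ennreal_mult) (auto simp: mult.assoc)
    finally have le: "ennreal (\<bar>f z\<bar> powr p * (s k / 8) ^ DIM((real ^ 'n) \<times> real))
        \<le> ennreal (C0 * (1 / m * s k powr - \<alpha>)) * ?J" .
    let ?h = "(8 / s k) ^ DIM((real ^ 'n) \<times> real)"
    have "ennreal (\<bar>f z\<bar> powr p) = ennreal ?h * ennreal (\<bar>f z\<bar> powr p * (s k / 8) ^ DIM((real ^ 'n) \<times> real))"
      using s[of k] by (simp add: field_simps power_divide flip: ennreal_mult)
    also have "\<dots> \<le> ennreal ?h * (ennreal (C0 * (1 / m * s k powr - \<alpha>)) * ?J)"
      by (intro mult_left_mono le) simp
    also have "\<dots> = ennreal (?h * (C0 * (1 / m * s k powr - \<alpha>))) * ?J"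
      using s[of k] C0(1) m by (subst ennreal_mult) (auto simp: mult.assoc)
    also have "?h * (C0 * (1 / m * s k powr - \<alpha>)) = C * s k powr - (?n + \<alpha>)"
    proof -
      have "s k powr - (?n + \<alpha>) = s k powr - \<alpha> * s k powr - real (CARD('n) + 1)"
        by (subst powr_add[symmetric]) (simp add: algebra_simps)
      also have "s k powr - real (CARD('n) + 1) = 1 / s k ^ DIM((real ^ 'n) \<times> real)"
        using s[of k] by (simp only: powr_minus_divide powr_realpow DIM)
      finally have "s k powr - (?n + \<alpha>) = s k powr - \<alpha> * (1 / s k ^ DIM((real ^ 'n) \<times> real))" .
      then show ?thesis
        by (simp add: C_def power_divide ac_simps del: power_Suc)
    qed
    finally show ?thesis .
  qed
  moreover have "0 < C"
    using C0(1) m by (simp add: C_def)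
  ultimately show ?thesis
    using that by blast
qed

section \<open>Carleson measures\<close>

abbreviation (input) weighted_integral :: "real \<Rightarrow> real \<Rightarrow> ((real ^ 'n) \<times> real \<Rightarrow> real) \<Rightarrow> ((real ^ 'n) \<times> real) set \<Rightarrow> ennreal" where
  "weighted_integral \<alpha> p f A \<equiv> \<integral>\<^sup>+z\<in>A. ennreal (\<bar>f z\<bar> powr p * snd z powr \<alpha>) \<partial>lborel"

text \<open>Translates (2) into side lengths, the quantity in which both implications are
  scaled.\<close>

lemma measure_cube_powr:
  fixes c :: "(real ^ 'n) \<times> real"
  assumes "0 < s"
  shows "measure lborel (cube c s) powr (real m * (1 + \<alpha> / (real CARD('n) + 1)))
     = s powr (real m * (real CARD('n) + 1 + \<alpha>))"
proof -
  have "measure lborel (cube c s) = s powr (real CARD('n) + 1)"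
    using assms powr_realpow[of s "CARD('n) + 1"] by (simp add: measure_cube add.commute)
  moreover have "(real CARD('n) + 1) * (real m * (1 + \<alpha> / (real CARD('n) + 1))) = real m * (real CARD('n) + 1 + \<alpha>)"
    by (simp add: field_simps add_eq_0_iff)
  ultimately show ?thesis
    by (simp only: powr_powr)
qed

lemma ennreal_le_divide_if_mult_le:
  assumes "0 < x" "ennreal x * a \<le> ennreal y"
  shows "a \<le> ennreal (y / x)"
proof -
  have "a = ennreal (1 / x) * (ennreal x * a)"
    using assms(1) by (simp add: mult.assoc[symmetric] flip: ennreal_mult)
  also have "\<dots> \<le> ennreal (1 / x) * ennreal y"
    by (intro mult_left_mono assms) simp
  also have "\<dots> = ennreal (y / x)"
    using assms(1) by (simp flip: ennreal_mult')
  finally show ?thesis .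
qed

section \<open>From the measure condition to the embedding\<close>

lemma Carleson_imp_embedding:
  fixes \<mu> :: "((real ^ 'n) \<times> real) measure" and \<zeta> :: "nat \<Rightarrow> (real ^ 'n) \<times> real"
  assumes W: "whitney_decomposition \<zeta> s" and E: "whitney_enlargement \<zeta> s"
    and \<mu>: "sets \<mu> = sets (restrict_space borel half_space)"
    and p: "\<And>i. i \<in> {1..m} \<Longrightarrow> 0 < p i" and q: "\<And>i. i \<in> {1..m} \<Longrightarrow> 0 < q i" "(\<Sum>i=1..m. 1 / q i) = 1"
    and C: "0 < C" "\<And>k. emeasure \<mu> (cube (\<zeta> k) (s k)) \<le> ennreal (C * s k powr (real m * (real CARD('n) + 1 + \<alpha>)))"
  obtains C' where "0 < C'" "\<And>f. (\<And>i. i \<in> {1..m} \<Longrightarrow> harmonic_on half_space (f i)) \<Longrightarrow>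
     (\<integral>\<^sup>+z. ennreal (\<Prod>i=1..m. \<bar>f i z\<bar> powr p i) \<partial>\<mu>) \<le> ennreal C' *
       (\<Prod>i=1..m. ennpowr (\<Sum>k. ennpowr (weighted_integral \<alpha> (p i) (f i) (enlarged_cube (\<zeta> k) (s k))) (q i)) (1 / q i))"
proof -
  let ?d = "real CARD('n) + 1 + \<alpha>"
  let ?\<Delta> = "\<lambda>k. cube (\<zeta> k) (s k)"
  have s: "0 < s k" for k
    using W by (simp add: whitney_decomposition_def)
  have cover: "(\<Union>k. ?\<Delta> k) = half_space"
    using W by (simp add: whitney_decomposition_def)
  have "\<exists>c>0. \<forall>f k z. harmonic_on half_space f \<longrightarrow> z \<in> ?\<Delta> k \<longrightarrow>
      ennreal (\<bar>f z\<bar> powr p i) \<le> ennreal (c * s k powr - ?d) * weighted_integral \<alpha> (p i) f (enlarged_cube (\<zeta> k) (s k))"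
    if "i \<in> {1..m}" for i
    by (rule harmonic_powr_le_on_cube[OF W E p[OF that], of \<alpha>]) blast
  then have "\<forall>i\<in>{1..m}. \<exists>c>0. \<forall>f k z. harmonic_on half_space f \<longrightarrow> z \<in> ?\<Delta> k \<longrightarrow>
      ennreal (\<bar>f z\<bar> powr p i) \<le> ennreal (c * s k powr - ?d) * weighted_integral \<alpha> (p i) f (enlarged_cube (\<zeta> k) (s k))"
    by (rule ballI)
  from bchoice[OF this] obtain c where c': "\<forall>i\<in>{1..m}. 0 < c i \<and>
      (\<forall>f k z. harmonic_on half_space f \<longrightarrow> z \<in> ?\<Delta> k \<longrightarrow>
        ennreal (\<bar>f z\<bar> powr p i) \<le> ennreal (c i * s k powr - ?d) * weighted_integral \<alpha> (p i) f (enlarged_cube (\<zeta> k) (s k)))"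
    by (elim exE) (rule that)
  have c: "\<And>i. i \<in> {1..m} \<Longrightarrow> 0 < c i"
    "\<And>i f k z. i \<in> {1..m} \<Longrightarrow> harmonic_on half_space f \<Longrightarrow> z \<in> ?\<Delta> k \<Longrightarrow>
      ennreal (\<bar>f z\<bar> powr p i) \<le> ennreal (c i * s k powr - ?d) * weighted_integral \<alpha> (p i) f (enlarged_cube (\<zeta> k) (s k))"
    using c' by blast+
  define C' where "C' = C * (\<Prod>i=1..m. c i)"
  have prod_c: "0 < (\<Prod>i=1..m. c i)"
    using c(1) by (intro prod_pos) auto
  have "(\<integral>\<^sup>+z. ennreal (\<Prod>i=1..m. \<bar>f i z\<bar> powr p i) \<partial>\<mu>) \<le> ennreal C' *
       (\<Prod>i=1..m. ennpowr (\<Sum>k. ennpowr (weighted_integral \<alpha> (p i) (f i) (enlarged_cube (\<zeta> k) (s k))) (q i)) (1 / q i))"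
    if f: "\<And>i. i \<in> {1..m} \<Longrightarrow> harmonic_on half_space (f i)" for f
  proof -
    define J where "J i k = weighted_integral \<alpha> (p i) (f i) (enlarged_cube (\<zeta> k) (s k))" for i k
    define B where "B k = (\<Prod>i=1..m. ennreal (c i * s k powr - ?d) * J i k)" for k
    have B: "B k = ennreal ((\<Prod>i=1..m. c i) * s k powr (- (real m * ?d))) * (\<Prod>i=1..m. J i k)" for k
    proof -
      have "(\<Prod>i=1..m. ennreal (c i * s k powr - ?d)) = ennreal (\<Prod>i=1..m. c i * s k powr - ?d)"
        using c(1) by (intro prod_ennreal) (auto simp: less_imp_le)
      also have "(\<Prod>i=1..m. c i * s k powr - ?d) = (\<Prod>i=1..m. c i) * s k powr (- (real m * ?d))"
      proof -
        have "(s k powr - ?d) ^ m = (s k powr - ?d) powr real m"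
          using s[of k] by (subst powr_realpow) auto
        also have "\<dots> = s k powr (- (real m * ?d))"
          unfolding powr_powr by (rule arg_cong[where f="\<lambda>r. _ powr r"]) (simp add: algebra_simps)
        finally show ?thesis
          by (simp add: prod.distrib)
      qed
      finally show ?thesis
        by (simp add: B_def prod.distrib)
    qed
    have \<Delta>_sets: "?\<Delta> k \<in> sets \<mu>" for k
    proof -
      have "?\<Delta> k = half_space \<inter> ?\<Delta> k"
        using cover by auto
      moreover have "?\<Delta> k \<in> sets borel"
        by (simp add: cube_def)
      ultimately show ?thesis
        unfolding \<mu> sets_restrict_space by blast
    qed
    have "space \<mu> = half_space"
      using sets_eq_imp_space_eq[OF \<mu>] by (simp add: space_restrict_space)
    \<comment> \<open>Only the covering property matters here: \<mu> may charge faces shared by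
      several cubes, and counting these repeatedly just enlarges the right-hand side.\<close>
    have "(\<integral>\<^sup>+z. ennreal (\<Prod>i=1..m. \<bar>f i z\<bar> powr p i) \<partial>\<mu>) \<le> (\<integral>\<^sup>+z. (\<Sum>k. B k * indicator (?\<Delta> k) z) \<partial>\<mu>)"
    proof (intro nn_integral_mono)
      fix z assume "z \<in> space \<mu>"
      then obtain k where k: "z \<in> ?\<Delta> k"
        using cover \<open>space \<mu> = half_space\<close> by auto
      have "ennreal (\<Prod>i=1..m. \<bar>f i z\<bar> powr p i) = (\<Prod>i=1..m. ennreal (\<bar>f i z\<bar> powr p i))"
        by (intro prod_ennreal[symmetric]) simp
      also have "\<dots> \<le> B k * indicator (?\<Delta> k) z"
        using k c(2)[OF _ f k] by (auto simp: B_def J_def intro!: prod_mono_ennreal)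
      also have "\<dots> \<le> (\<Sum>k. B k * indicator (?\<Delta> k) z)"
        by (rule le_suminf_ennreal)
      finally show "ennreal (\<Prod>i=1..m. \<bar>f i z\<bar> powr p i) \<le> (\<Sum>k. B k * indicator (?\<Delta> k) z)" .
    qed
    also have "\<dots> = (\<Sum>k. B k * emeasure \<mu> (?\<Delta> k))"
      using \<Delta>_sets by (subst nn_integral_suminf) (auto simp: nn_integral_cmult_indicator)
    also have "\<dots> \<le> (\<Sum>k. ennreal C' * (\<Prod>i=1..m. J i k))"
    proof (intro suminf_le summableI)
      fix k
      have "B k * emeasure \<mu> (?\<Delta> k) \<le> B k * ennreal (C * s k powr (real m * ?d))"
        by (intro mult_left_mono C) simp
      also have "\<dots> = (ennreal ((\<Prod>i=1..m. c i) * s k powr (- (real m * ?d))) * ennreal (C * s k powr (real m * ?d))) * (\<Prod>i=1..m. J i k)"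
        by (simp only: B ac_simps)
      also have "ennreal ((\<Prod>i=1..m. c i) * s k powr (- (real m * ?d))) * ennreal (C * s k powr (real m * ?d))
          = ennreal (((\<Prod>i=1..m. c i) * s k powr (- (real m * ?d))) * (C * s k powr (real m * ?d)))"
        using prod_c C(1) by (intro ennreal_mult[symmetric]) auto
      also have "((\<Prod>i=1..m. c i) * s k powr (- (real m * ?d))) * (C * s k powr (real m * ?d)) = C'"
        using s[of k] unfolding C'_def powr_minus by (simp add: field_simps)
      finally show "B k * emeasure \<mu> (?\<Delta> k) \<le> ennreal C' * (\<Prod>i=1..m. J i k)" .
    qed
    also have "\<dots> = ennreal C' * (\<Sum>k. \<Prod>i=1..m. J i k)"
      by simp
    also have "\<dots> \<le> ennreal C' * (\<Prod>i=1..m. ennpowr (\<Sum>k. ennpowr (J i k) (q i)) (1 / q i))"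
      using q by (intro mult_left_mono Hoelder_suminf_prod_ennreal) auto
    finally show ?thesis
      by (simp add: J_def)
  qed
  moreover have "0 < C'"
    using C(1) prod_c by (simp add: C'_def)
  ultimately show ?thesis
    using that by blast
qed

section \<open>From the embedding to the measure condition\<close>

lemma borel_measurable_kelvin_translate: "(\<lambda>z. kelvin e1 e2 c N (z - v)) \<in> borel_measurable borel"
proof -
  have "(\<lambda>z. Re (c * planar e1 e2 (z - v) ^ (N + 2))) \<in> borel_measurable borel"
    by (intro borel_measurable_continuous_onI continuous_intros
        bounded_linear.continuous_on[OF bounded_linear_planar])
  moreover have "(\<lambda>z. (z - v) \<bullet> (z - v)) \<in> borel_measurable borel"
    by (intro borel_measurable_continuous_onI continuous_intros)
  ultimately show ?thesis
    unfolding kelvin_def by measurable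
qed

text \<open>The outer l^q norm is replaced by the l^1 norm, which bounded overlap turns into one
  integral over the half-space. The point is uniformity: \<open>K\<close> does not depend on c,
  \<xi>, \<eta>, so one constant serves the test functions of all cubes. The hypothesis on N makes
  the p-th power decay fast enough for that integral.\<close>

lemma weighted_sum_kelvin_le:
  fixes \<zeta> :: "nat \<Rightarrow> (real ^ 'n) \<times> real"
  assumes E: "whitney_enlargement \<zeta> s" and \<alpha>: "- 1 < \<alpha>" and p: "0 < p" and q: "1 \<le> q"
    and M: "2 * real CARD('n) + \<alpha> + 2 \<le> (real N + real CARD('n) + 1) * p"
    and e: "e1 \<in> Basis" "e2 \<in> Basis" "e1 \<noteq> e2"
  obtains K where "0 < K" "\<And>c \<xi> \<eta>. cmod c = 1 \<Longrightarrow> 0 < \<eta> \<Longrightarrow>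
    ennpowr (\<Sum>k. ennpowr (weighted_integral \<alpha> p (\<lambda>z. kelvin e1 e2 c N (z - (\<xi>, - \<eta>))) (enlarged_cube (\<zeta> k) (s k))) q) (1 / q)
     \<le> ennreal (K * \<eta> powr (real CARD('n) + 1 + \<alpha> - (real N + real CARD('n) + 1) * p))"
proof -
  let ?M = "(real N + real CARD('n) + 1) * p"
  let ?E = "\<lambda>k. enlarged_cube (\<zeta> k) (s k)"
  obtain N0 where N0: "\<And>z. finite {k. z \<in> ?E k}" "\<And>z. card {k. z \<in> ?E k} \<le> N0"
    and sub: "\<And>k. ?E k \<subseteq> half_space"
    using E unfolding whitney_enlargement_def by blast
  obtain K where K: "0 < K" "\<And>(\<xi> :: real ^ 'n) \<eta>. 0 < \<eta> \<Longrightarrow>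
       (\<integral>\<^sup>+z\<in>half_space. ennreal (norm (z - (\<xi>, - \<eta>)) powr - ?M * snd z powr \<alpha>) \<partial>lborel)
         \<le> ennreal (K * \<eta> powr (real CARD('n) + 1 + \<alpha> - ?M))"
    using nn_integral_norm_powr_half_space[OF \<alpha> M] by blast
  define K' where "K' = (real N0 + 1) * K"
  have "ennpowr (\<Sum>k. ennpowr (weighted_integral \<alpha> p (\<lambda>z. kelvin e1 e2 c N (z - (\<xi>, - \<eta>))) (?E k)) q) (1 / q)
     \<le> ennreal (K' * \<eta> powr (real CARD('n) + 1 + \<alpha> - ?M))"
    if c: "cmod c = 1" and \<eta>: "0 < \<eta>" for c \<xi> \<eta>
  proof -
    define g where "g z = ennreal (norm (z - (\<xi>, - \<eta>)) powr - ?M * snd z powr \<alpha>)" for z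
    let ?J = "\<lambda>k. weighted_integral \<alpha> p (\<lambda>z. kelvin e1 e2 c N (z - (\<xi>, - \<eta>))) (?E k)"
    have [measurable]: "g \<in> borel_measurable lborel"
    proof -
      have [measurable]: "(\<lambda>z. norm (z - (\<xi>, - \<eta>))) \<in> borel_measurable borel"
        "snd \<in> borel_measurable (borel :: ((real ^ 'n) \<times> real) measure)"
        by (intro borel_measurable_continuous_onI continuous_intros)+
      show ?thesis
        unfolding g_def[abs_def] by simp
    qed
    have [measurable]: "?E k \<in> sets lborel" for k
      by (simp add: enlarged_cube_def cube_def)
    have [measurable]: "half_space \<in> sets (lborel :: ((real ^ 'n) \<times> real) measure)"
      by (simp add: borel_open[OF open_half_space])
    have J_le: "?J k \<le> (\<integral>\<^sup>+z. g z * indicator (?E k) z \<partial>lborel)" for k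
    proof (intro nn_integral_mono mult_right_mono)
      fix z :: "(real ^ 'n) \<times> real"
      have "\<bar>kelvin e1 e2 c N (z - (\<xi>, - \<eta>))\<bar> powr p
          \<le> (norm (z - (\<xi>, - \<eta>)) powr - (real N + real DIM((real ^ 'n) \<times> real))) powr p"
        using p by (intro powr_mono2 abs_kelvin_le e c) auto
      also have "\<dots> = norm (z - (\<xi>, - \<eta>)) powr - ?M"
        unfolding powr_powr by (rule arg_cong[where f="\<lambda>r. _ powr r"]) (simp add: algebra_simps)
      finally show "ennreal (\<bar>kelvin e1 e2 c N (z - (\<xi>, - \<eta>))\<bar> powr p * snd z powr \<alpha>) \<le> g z"
        unfolding g_def by (intro ennreal_leI mult_right_mono) auto
    qed simp
    have "(\<Sum>k. ?J k) \<le> (\<Sum>k. \<integral>\<^sup>+z. g z * indicator (?E k) z \<partial>lborel)"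
      by (intro suminf_le J_le summableI)
    also have "\<dots> = (\<integral>\<^sup>+z. (\<Sum>k. g z * indicator (?E k) z) \<partial>lborel)"
      by (intro nn_integral_suminf[symmetric]) measurable
    also have "\<dots> \<le> (\<integral>\<^sup>+z. ennreal (real N0 + 1) * (g z * indicator half_space z) \<partial>lborel)"
    proof (intro nn_integral_mono)
      fix z
      have "(\<Sum>k. g z * indicator (?E k) z) = (\<Sum>k\<in>{k. z \<in> ?E k}. g z * indicator (?E k) z)"
        by (intro suminf_finite N0) auto
      also have "\<dots> = of_nat (card {k. z \<in> ?E k}) * (g z * indicator half_space z)"
      proof -
        have "(\<Sum>k\<in>{k. z \<in> ?E k}. g z * indicator (?E k) z) = (\<Sum>k\<in>{k. z \<in> ?E k}. g z * indicator half_space z)"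
          using sub by (intro sum.cong) (auto split: split_indicator)
        then show ?thesis by simp
      qed
      also have "\<dots> \<le> ennreal (real N0 + 1) * (g z * indicator half_space z)"
      proof (intro mult_right_mono)
        have "ennreal (real (card {k. z \<in> ?E k})) \<le> ennreal (real N0 + 1)"
          using N0(2)[of z] by (intro ennreal_leI) linarith
        then show "of_nat (card {k. z \<in> ?E k}) \<le> ennreal (real N0 + 1)"
          by (simp add: ennreal_of_nat_eq_real_of_nat)
      qed simp
      finally show "(\<Sum>k. g z * indicator (?E k) z) \<le> ennreal (real N0 + 1) * (g z * indicator half_space z)" .
    qed
    also have "\<dots> = ennreal (real N0 + 1) * (\<integral>\<^sup>+z. g z * indicator half_space z \<partial>lborel)"
      by (intro nn_integral_cmult) measurable
    also have "\<dots> \<le> ennreal (real N0 + 1) * ennreal (K * \<eta> powr (real CARD('n) + 1 + \<alpha> - ?M))"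
      unfolding g_def by (intro mult_left_mono K \<eta>) simp
    also have "\<dots> = ennreal (K' * \<eta> powr (real CARD('n) + 1 + \<alpha> - ?M))"
      unfolding K'_def mult.assoc using K(1) by (intro ennreal_mult[symmetric]) auto
    finally have sum_J: "(\<Sum>k. ?J k) \<le> ennreal (K' * \<eta> powr (real CARD('n) + 1 + \<alpha> - ?M))" .
    have "ennpowr (\<Sum>k. ennpowr (?J k) q) (1 / q) \<le> ennpowr (ennpowr (\<Sum>k. ?J k) q) (1 / q)"
      using q by (intro ennpowr_mono suminf_ennpowr_le) auto
    also have "\<dots> = (\<Sum>k. ?J k)"
      using q by (intro ennpowr_ennpowr_inverse) simp
    finally show ?thesis
      using sum_J by (rule order_trans)
  qed
  moreover have "0 < K'"
    using K(1) by (simp add: K'_def add_nonneg_pos)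
  ultimately show ?thesis
    using that by blast
qed

lemma embedding_imp_Carleson:
  fixes \<mu> :: "((real ^ 'n) \<times> real) measure" and \<zeta> :: "nat \<Rightarrow> (real ^ 'n) \<times> real"
  assumes W: "whitney_decomposition \<zeta> s" and E: "whitney_enlargement \<zeta> s"
    and \<mu>: "sets \<mu> = sets (restrict_space borel half_space)"
    and p: "\<And>i. i \<in> {1..m} \<Longrightarrow> 0 < p i" and q: "\<And>i. i \<in> {1..m} \<Longrightarrow> 0 < q i" "(\<Sum>i=1..m. 1 / q i) = 1"
    and \<alpha>: "- 1 < \<alpha>"
    and C: "0 < C" "\<And>f. (\<And>i. i \<in> {1..m} \<Longrightarrow> harmonic_on half_space (f i)) \<Longrightarrow>
     (\<integral>\<^sup>+z. ennreal (\<Prod>i=1..m. \<bar>f i z\<bar> powr p i) \<partial>\<mu>) \<le> ennreal C *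
       (\<Prod>i=1..m. ennpowr (\<Sum>k. ennpowr (weighted_integral \<alpha> (p i) (f i) (enlarged_cube (\<zeta> k) (s k))) (q i)) (1 / q i))"
  obtains C' where "0 < C'"
    "\<And>k. emeasure \<mu> (cube (\<zeta> k) (s k)) \<le> ennreal (C' * s k powr (real m * (real CARD('n) + 1 + \<alpha>)))"
proof -
  let ?d = "real CARD('n) + 1"
  obtain L where L: "0 < L" and s: "\<And>k. 0 < s k" and \<eta>: "\<And>k. 0 < snd (\<zeta> k)"
    and s\<eta>: "\<And>k. s k \<le> 2 * snd (\<zeta> k)" "\<And>k. snd (\<zeta> k) \<le> L * s k"
    using whitney_side_comparable[OF W E] by blast
  have m: "{1..m} \<noteq> {}"
    using q(2) by (metis sum.empty zero_neq_one)
  \<comment> \<open>Each 1 / q_i is one of the positive terms that add up to 1.\<close>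
  have q1: "1 \<le> q i" if i: "i \<in> {1..m}" for i
  proof -
    have "1 / q i \<le> (\<Sum>i=1..m. 1 / q i)"
      using i q(1) by (intro member_le_sum) (auto simp: less_imp_le)
    then show ?thesis
      using q(1)[OF i] q(2) by (simp add: field_simps)
  qed
  define P where "P = (\<Sum>i=1..m. p i)"
  have P: "0 < P"
    unfolding P_def using p m by (intro sum_pos) auto
  obtain u :: "real ^ 'n" where u: "u \<in> Basis"
    using nonempty_Basis by blast
  let ?e1 = "(u, 0) :: (real ^ 'n) \<times> real" and ?e2 = "(0, 1) :: (real ^ 'n) \<times> real"
  have e: "?e1 \<in> Basis" "?e2 \<in> Basis" "?e1 \<noteq> ?e2"
    using u by (auto simp: Basis_prod_def)
  \<comment> \<open>One N has to serve all exponents; exceeding the sum of the quotients R / p_i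
    makes it exceed each of them.\<close>
  obtain N :: nat where N: "\<And>i. i \<in> {1..m} \<Longrightarrow> 2 * real CARD('n) + \<alpha> + 2 \<le> (real N + real CARD('n) + 1) * p i"
  proof -
    let ?R = "2 * real CARD('n) + \<alpha> + 2"
    obtain N :: nat where N: "(\<Sum>i=1..m. ?R / p i) \<le> real N"
      using real_arch_simple by blast
    have "?R \<le> (real N + real CARD('n) + 1) * p i" if i: "i \<in> {1..m}" for i
    proof -
      have "?R / p i \<le> (\<Sum>i=1..m. ?R / p i)"
        using i p \<alpha> by (intro member_le_sum) (auto simp: less_imp_le)
      with N have "?R / p i \<le> real N + real CARD('n) + 1"
        by linarith
      then show ?thesis
        using p[OF i] by (simp add: pos_divide_le_eq)
    qed
    then show ?thesis by (rule that)
  qed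
  let ?M = "real N + real CARD('n) + 1"
  let ?u = "\<lambda>c \<xi> \<eta> z. kelvin ?e1 ?e2 c N (z - (\<xi>, - \<eta>))"
  have "\<exists>K>0. \<forall>c \<xi> \<eta>. cmod c = 1 \<longrightarrow> 0 < \<eta> \<longrightarrow>
    ennpowr (\<Sum>k. ennpowr (weighted_integral \<alpha> (p i) (?u c \<xi> \<eta>) (enlarged_cube (\<zeta> k) (s k))) (q i)) (1 / q i)
     \<le> ennreal (K * \<eta> powr (?d + \<alpha> - ?M * p i))" if i: "i \<in> {1..m}" for i
    by (rule weighted_sum_kelvin_le[OF E \<alpha> p[OF i] q1[OF i] N[OF i] e]) blast
  then have "\<forall>i\<in>{1..m}. \<exists>K>0. \<forall>c \<xi> \<eta>. cmod c = 1 \<longrightarrow> 0 < \<eta> \<longrightarrow>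
    ennpowr (\<Sum>k. ennpowr (weighted_integral \<alpha> (p i) (?u c \<xi> \<eta>) (enlarged_cube (\<zeta> k) (s k))) (q i)) (1 / q i)
     \<le> ennreal (K * \<eta> powr (?d + \<alpha> - ?M * p i))"
    by (rule ballI)
  from bchoice[OF this] obtain K where K': "\<forall>i\<in>{1..m}. 0 < K i \<and> (\<forall>c \<xi> \<eta>. cmod c = 1 \<longrightarrow> 0 < \<eta> \<longrightarrow>
    ennpowr (\<Sum>k. ennpowr (weighted_integral \<alpha> (p i) (?u c \<xi> \<eta>) (enlarged_cube (\<zeta> k) (s k))) (q i)) (1 / q i)
     \<le> ennreal (K i * \<eta> powr (?d + \<alpha> - ?M * p i)))"
    by (elim exE) (rule that)
  have K: "0 < K i" if "i \<in> {1..m}" for i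
    using K' that by blast
  have prod_K: "0 < (\<Prod>i=1..m. K i)"
    using K by (intro prod_pos) auto
  have test: "(\<integral>\<^sup>+z. ennreal (\<bar>?u c \<xi> \<eta> z\<bar> powr P) \<partial>\<mu>)
      \<le> ennreal (C * (\<Prod>i=1..m. K i) * \<eta> powr (real m * (?d + \<alpha>) - ?M * P))"
    if c: "cmod c = 1" and \<eta>: "0 < \<eta>" for c \<xi> \<eta>
  proof -
    \<comment> \<open>At a zero of the test function the law of exponents fails for an empty
      product; both sides are 0 because m >= 1.\<close>
    have powr_P: "\<bar>?u c \<xi> \<eta> z\<bar> powr P = (\<Prod>i=1..m. \<bar>?u c \<xi> \<eta> z\<bar> powr p i)" for z
    proof (cases "?u c \<xi> \<eta> z = 0")
      case True
      then show ?thesis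
        using m P by (simp add: card_gt_0_iff)
    next
      case False
      then show ?thesis
        unfolding P_def by (intro powr_sum) auto
    qed
    have harm: "harmonic_on half_space (?u c \<xi> \<eta>)"
    proof (rule harmonic_on_translate[OF harmonic_on_kelvin[OF e] open_half_space])
      fix z :: "(real ^ 'n) \<times> real" assume "z \<in> half_space"
      then have "snd (z - (\<xi>, - \<eta>)) \<noteq> 0"
        using \<eta> by (simp add: half_space_def)
      then show "z - (\<xi>, - \<eta>) \<in> - {0}"
        by force
    qed
    have "(\<integral>\<^sup>+z. ennreal (\<bar>?u c \<xi> \<eta> z\<bar> powr P) \<partial>\<mu>) \<le> ennreal C *
       (\<Prod>i=1..m. ennpowr (\<Sum>k. ennpowr (weighted_integral \<alpha> (p i) (?u c \<xi> \<eta>) (enlarged_cube (\<zeta> k) (s k))) (q i)) (1 / q i))"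
      unfolding powr_P using C(2)[of "\<lambda>_. ?u c \<xi> \<eta>"] harm by simp
    also have "\<dots> \<le> ennreal C * (\<Prod>i=1..m. ennreal (K i * \<eta> powr (?d + \<alpha> - ?M * p i)))"
      using K' c \<eta> by (intro mult_left_mono prod_mono_ennreal) auto
    also have "(\<Prod>i=1..m. ennreal (K i * \<eta> powr (?d + \<alpha> - ?M * p i))) = ennreal (\<Prod>i=1..m. K i * \<eta> powr (?d + \<alpha> - ?M * p i))"
      using K by (intro prod_ennreal) (auto simp: less_imp_le)
    also have "(\<Prod>i=1..m. K i * \<eta> powr (?d + \<alpha> - ?M * p i)) = (\<Prod>i=1..m. K i) * \<eta> powr (\<Sum>i=1..m. ?d + \<alpha> - ?M * p i)"
      unfolding prod.distrib using \<eta> by (simp add: powr_sum)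
    also have "(\<Sum>i=1..m. ?d + \<alpha> - ?M * p i) = real m * (?d + \<alpha>) - ?M * P"
      by (simp add: sum_subtractf P_def sum_distrib_left)
    also have "ennreal C * ennreal ((\<Prod>i=1..m. K i) * \<eta> powr (real m * (?d + \<alpha>) - ?M * P))
        = ennreal (C * ((\<Prod>i=1..m. K i) * \<eta> powr (real m * (?d + \<alpha>) - ?M * P)))"
      using C(1) prod_K by (intro ennreal_mult[symmetric]) auto
    finally show ?thesis
      by (simp only: mult.assoc)
  qed
  \<comment> \<open>n + 3 = (n + 1) + 2: a point of the cube is within (n + 1) s/2 <= (n + 1) \<eta>
    of the center, and the center is at distance 2 \<eta> from its reflection.\<close>
  define B where "B = real CARD('n) + 3"
  define \<kappa> where "\<kappa> = (1 / 2 * B powr (- (2 * real N + 2 + ?d))) powr P"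
  have B: "0 < B"
    by (simp add: B_def)
  have \<kappa>: "0 < \<kappa>"
    using B by (simp add: \<kappa>_def)
  define C' where "C' = 2 * C * (\<Prod>i=1..m. K i) / \<kappa> * L powr (real m * (?d + \<alpha>))"
  have "emeasure \<mu> (cube (\<zeta> k) (s k)) \<le> ennreal (C' * s k powr (real m * (?d + \<alpha>)))" for k
  proof -
    let ?\<eta> = "snd (\<zeta> k)" and ?\<xi> = "fst (\<zeta> k)"
    let ?A = "2 * C * (\<Prod>i=1..m. K i) * ?\<eta> powr (real m * (?d + \<alpha>) - ?M * P)"
    let ?\<Delta> = "cube (\<zeta> k) (s k)"
    \<comment> \<open>Over the cube \<open>planar\<close>, taken from the reflected center, has
      modulus at least \<eta>, and the distance to that pole is at most B \<eta>. The resulting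
      bound is homogeneous in \<eta> of degree N + 2 - (2N + 2 + n + 1) = -(N + n + 1) before the
      power P is taken.\<close>
    have lower: "\<kappa> * ?\<eta> powr (- (?M * P)) \<le> \<bar>?u 1 ?\<xi> ?\<eta> z\<bar> powr P + \<bar>?u (- \<i>) ?\<xi> ?\<eta> z\<bar> powr P"
      if z: "z \<in> ?\<Delta>" for z
    proof -
      have "z \<in> half_space"
        using z W unfolding whitney_decomposition_def by blast
      then have "?\<eta> \<le> \<bar>Re (planar ?e1 ?e2 (z - (?\<xi>, - ?\<eta>)))\<bar>"
        by (simp add: planar_def inner_prod_def half_space_def)
      also have "\<dots> \<le> cmod (planar ?e1 ?e2 (z - (?\<xi>, - ?\<eta>)))"
        by (rule abs_Re_le_cmod)
      finally have low: "?\<eta> \<le> cmod (planar ?e1 ?e2 (z - (?\<xi>, - ?\<eta>)))" .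
      have "z - (?\<xi>, - ?\<eta>) = (z - \<zeta> k) + (0, 2 * ?\<eta>)"
        by (simp add: prod_eq_iff)
      then have "norm (z - (?\<xi>, - ?\<eta>)) \<le> norm (z - \<zeta> k) + norm ((0, 2 * ?\<eta>) :: (real ^ 'n) \<times> real)"
        by (simp only: norm_triangle_ineq)
      also have "norm ((0, 2 * ?\<eta>) :: (real ^ 'n) \<times> real) = 2 * ?\<eta>"
        using \<eta>[of k] by (simp add: norm_Pair real_sqrt_mult)
      also have "norm (z - \<zeta> k) \<le> ?d * (s k / 2)"
        using norm_le_if_mem_cube[OF z] by (simp add: add.commute)
      also have "?d * (s k / 2) \<le> ?d * ?\<eta>"
        using s\<eta>(1)[of k] by (intro mult_left_mono) auto
      finally have up: "norm (z - (?\<xi>, - ?\<eta>)) \<le> B * ?\<eta>"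
        by (simp add: B_def algebra_simps)
      have "\<kappa> * ?\<eta> powr (- (?M * P)) = (1 / 2 * B powr (- (2 * real N + 2 + ?d)) * ?\<eta> powr (- ?M)) powr P"
      proof -
        have "?\<eta> powr (- (?M * P)) = (?\<eta> powr (- ?M)) powr P"
          by (simp only: powr_powr mult_minus_left)
        then show ?thesis
          by (simp only: \<kappa>_def powr_mult)
      qed
      also have "1 / 2 * B powr (- (2 * real N + 2 + ?d)) * ?\<eta> powr (- ?M)
          = ?\<eta> ^ (N + 2) / 2 * (B * ?\<eta>) powr (- (2 * real N + 2 + DIM((real ^ 'n) \<times> real)))"
      proof -
        have "?\<eta> powr (- ?M) = ?\<eta> powr real (N + 2) * ?\<eta> powr (- (2 * real N + 2 + ?d))"
          unfolding powr_add[symmetric] by (rule arg_cong[where f="\<lambda>r. _ powr r"]) simp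
        also have "?\<eta> powr real (N + 2) = ?\<eta> ^ (N + 2)"
          using \<eta>[of k] by (intro powr_realpow)
        finally show ?thesis
          using B \<eta>[of k] by (simp add: powr_mult add.commute del: power_Suc)
      qed
      also have "\<dots> powr P \<le> \<bar>?u 1 ?\<xi> ?\<eta> z\<bar> powr P + \<bar>?u (- \<i>) ?\<xi> ?\<eta> z\<bar> powr P"
        by (rule kelvin_powr_ge[OF P \<eta> low up])
      finally show ?thesis .
    qed
    have meas: "(\<lambda>z. ennreal (\<bar>?u c ?\<xi> ?\<eta> z\<bar> powr P)) \<in> borel_measurable \<mu>" for c
    proof -
      have "(\<lambda>z. ennreal (\<bar>?u c ?\<xi> ?\<eta> z\<bar> powr P)) \<in> borel_measurable borel"
        using borel_measurable_kelvin_translate[of ?e1 ?e2 c N] by measurable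
      then have "(\<lambda>z. ennreal (\<bar>?u c ?\<xi> ?\<eta> z\<bar> powr P)) \<in> borel_measurable (restrict_space borel half_space)"
        by (rule measurable_restrict_space1)
      then show ?thesis
        using measurable_cong_sets[OF \<mu> refl] by blast
    qed
    have \<Delta>_sets: "?\<Delta> \<in> sets \<mu>"
    proof -
      have "?\<Delta> = half_space \<inter> ?\<Delta>"
        using W unfolding whitney_decomposition_def by blast
      moreover have "?\<Delta> \<in> sets borel"
        by (simp add: cube_def)
      ultimately show ?thesis
        unfolding \<mu> sets_restrict_space by blast
    qed
    have "ennreal (\<kappa> * ?\<eta> powr (- (?M * P))) * emeasure \<mu> ?\<Delta>
        = (\<integral>\<^sup>+z. ennreal (\<kappa> * ?\<eta> powr (- (?M * P))) * indicator ?\<Delta> z \<partial>\<mu>)"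
      using \<Delta>_sets by (simp add: nn_integral_cmult_indicator)
    also have "\<dots> \<le> (\<integral>\<^sup>+z. ennreal (\<bar>?u 1 ?\<xi> ?\<eta> z\<bar> powr P) + ennreal (\<bar>?u (- \<i>) ?\<xi> ?\<eta> z\<bar> powr P) \<partial>\<mu>)"
    proof (intro nn_integral_mono)
      fix z
      show "ennreal (\<kappa> * ?\<eta> powr (- (?M * P))) * indicator ?\<Delta> z
          \<le> ennreal (\<bar>?u 1 ?\<xi> ?\<eta> z\<bar> powr P) + ennreal (\<bar>?u (- \<i>) ?\<xi> ?\<eta> z\<bar> powr P)"
        using ennreal_leI[OF lower, of z] by (cases "z \<in> ?\<Delta>") (auto simp del: ennreal_plus simp flip: ennreal_plus)
    qed
    also have "\<dots> = (\<integral>\<^sup>+z. ennreal (\<bar>?u 1 ?\<xi> ?\<eta> z\<bar> powr P) \<partial>\<mu>) + (\<integral>\<^sup>+z. ennreal (\<bar>?u (- \<i>) ?\<xi> ?\<eta> z\<bar> powr P) \<partial>\<mu>)"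
      by (intro nn_integral_add meas)
    also have "\<dots> \<le> ennreal (C * (\<Prod>i=1..m. K i) * ?\<eta> powr (real m * (?d + \<alpha>) - ?M * P))
        + ennreal (C * (\<Prod>i=1..m. K i) * ?\<eta> powr (real m * (?d + \<alpha>) - ?M * P))"
      by (intro add_mono test \<eta>) auto
    also have "\<dots> = ennreal ?A"
      using C(1) prod_K by (subst ennreal_plus[symmetric]) auto
    finally have "emeasure \<mu> ?\<Delta> \<le> ennreal (?A / (\<kappa> * ?\<eta> powr (- (?M * P))))"
      using \<kappa> \<eta>[of k] by (intro ennreal_le_divide_if_mult_le) auto
    also have "?A / (\<kappa> * ?\<eta> powr (- (?M * P))) = 2 * C * (\<Prod>i=1..m. K i) / \<kappa> * ?\<eta> powr (real m * (?d + \<alpha>))"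
    proof -
      have "?\<eta> powr (real m * (?d + \<alpha>) - ?M * P) = ?\<eta> powr (real m * (?d + \<alpha>)) * ?\<eta> powr (- (?M * P))"
        unfolding powr_add[symmetric] by simp
      moreover have "?\<eta> powr (- (?M * P)) \<noteq> 0"
        using \<eta>[of k] by simp
      moreover have "a * (b * y) / (\<kappa> * y) = a / \<kappa> * b" if "y \<noteq> 0" for a b y :: real
        using that by simp
      ultimately show ?thesis
        by (simp only:)
    qed
    \<comment> \<open>Passing from the height to the side length uses \<eta> <= L s and a
      nonnegative exponent, which \<alpha> > -1 guarantees.\<close>
    also have "\<dots> \<le> 2 * C * (\<Prod>i=1..m. K i) / \<kappa> * (L * s k) powr (real m * (?d + \<alpha>))"
    proof (intro mult_left_mono powr_mono2 s\<eta>)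
      show "0 \<le> real m * (?d + \<alpha>)"
        using \<alpha> by (intro mult_nonneg_nonneg) auto
    qed (use C(1) prod_K \<kappa> \<eta>[of k] in auto)
    also have "\<dots> = C' * s k powr (real m * (?d + \<alpha>))"
      using L s[of k] by (simp add: C'_def powr_mult)
    finally show ?thesis
      by (simp add: ennreal_leI)
  qed
  moreover have "0 < C'"
    using C(1) prod_K \<kappa> L by (simp add: C'_def)
  ultimately show ?thesis
    using that by blast
qed

theorem theorem1:
  fixes \<mu> :: "((real ^ 'n) \<times> real) measure"
    and \<zeta> :: "nat \<Rightarrow> (real ^ 'n) \<times> real" and s :: "nat \<Rightarrow> real"
    and m :: nat and p q :: "nat \<Rightarrow> real" and \<alpha> :: real
  assumes "whitney_decomposition \<zeta> s" and "whitney_enlargement \<zeta> s"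
    and "sets \<mu> = sets (restrict_space borel half_space)"
    and "\<And>i. i \<in> {1..m} \<Longrightarrow> 0 < p i" and "\<And>i. i \<in> {1..m} \<Longrightarrow> 0 < q i"
    and "(\<Sum>i=1..m. 1 / q i) = 1"
    and "\<alpha> > -1"
  shows
    "(\<exists>C>0. \<forall>f :: nat \<Rightarrow> (real ^ 'n) \<times> real \<Rightarrow> real.
        (\<forall>i\<in>{1..m}. harmonic_on half_space (f i)) \<longrightarrow>
        (\<integral>\<^sup>+z. ennreal (\<Prod>i=1..m. \<bar>f i z\<bar> powr p i) \<partial>\<mu>)
          \<le> ennreal C * (\<Prod>i=1..m.
               ennpowr
                 (\<Sum>k. ennpowr
                    (\<integral>\<^sup>+z\<in>enlarged_cube (\<zeta> k) (s k).
                       ennreal (\<bar>f i z\<bar> powr p i * snd z powr \<alpha>) \<partial>lborel)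
                    (q i))
                 (1 / q i)))
     \<longleftrightarrow>
     (\<exists>C>0. \<forall>k.
        emeasure \<mu> (cube (\<zeta> k) (s k))
          \<le> ennreal (C * measure lborel (cube (\<zeta> k) (s k))
                         powr (real m * (1 + \<alpha> / (real CARD('n) + 1)))))"
    (is "?embedding \<longleftrightarrow> ?Carleson")
proof -
  have s: "0 < s k" for k
    using assms(1) by (simp add: whitney_decomposition_def)
  note cube_powr = measure_cube_powr[OF s]
  show ?thesis
  proof
    assume ?embedding
    then obtain C where C: "0 < C" "\<And>f. (\<And>i. i \<in> {1..m} \<Longrightarrow> harmonic_on half_space (f i)) \<Longrightarrow>
     (\<integral>\<^sup>+z. ennreal (\<Prod>i=1..m. \<bar>f i z\<bar> powr p i) \<partial>\<mu>) \<le> ennreal C *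
       (\<Prod>i=1..m. ennpowr (\<Sum>k. ennpowr (weighted_integral \<alpha> (p i) (f i) (enlarged_cube (\<zeta> k) (s k))) (q i)) (1 / q i))"
      by blast
    obtain C' where "0 < C'"
      "\<And>k. emeasure \<mu> (cube (\<zeta> k) (s k)) \<le> ennreal (C' * s k powr (real m * (real CARD('n) + 1 + \<alpha>)))"
      using embedding_imp_Carleson[where p=p and q=q, OF assms C] by blast
    then show ?Carleson
      unfolding cube_powr by blast
  next
    assume ?Carleson
    then obtain C where C: "0 < C"
      "\<And>k. emeasure \<mu> (cube (\<zeta> k) (s k)) \<le> ennreal (C * s k powr (real m * (real CARD('n) + 1 + \<alpha>)))"
      unfolding cube_powr by blast
    obtain C' where "0 < C'" "\<And>f. (\<And>i. i \<in> {1..m} \<Longrightarrow> harmonic_on half_space (f i)) \<Longrightarrow>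
     (\<integral>\<^sup>+z. ennreal (\<Prod>i=1..m. \<bar>f i z\<bar> powr p i) \<partial>\<mu>) \<le> ennreal C' *
       (\<Prod>i=1..m. ennpowr (\<Sum>k. ennpowr (weighted_integral \<alpha> (p i) (f i) (enlarged_cube (\<zeta> k) (s k))) (q i)) (1 / q i))"
      using Carleson_imp_embedding[where p=p and q=q, OF assms(1-6) C] by blast
    then show ?embedding
      by blast
  qed
qed

end
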